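(* Let $N\ge1$, let $a_1<b_1<\cdots<a_N<b_N$ be real and let $\alpha_1,\dots,\alpha_{N-1}\in\mathbb R$ be fixed. For an integer $n$ let $M=M_n$ be the solution of the model Riemann-Hilbert problem with parameters $n\alpha_1,\dots,n\alpha_{N-1}$. Then for every $\varepsilon>0$, $M_n(z)$ and $M_n(z)^{-1}$ are uniformly bounded in $n$ for $z$ in the set $$\{z\in\mathbb C\setminus[a_1,b_N] : |z-a_j|\ge\varepsilon,\ |z-b_j|\ge\varepsilon\ \text{ for all } j=1,\dots,N\},$$ that is, there is a constant $C$, independent of $n$ and of $z$ in this set, bounding the absolute values of all entries of $M_n(z)$ and $M_n(z)^{-1}$.
   Context: Model Riemann-Hilbert problem (for given $n$): find $M:\mathbb C\setminus[a_1,b_N]\to\mathbb C^{2\times2}$ such that (a) $M$ is analytic on $\mathbb C\setminus[a_1,b_N]$; (b) $M_+(x)=M_-(x)J_M(x)$, where $M_\pm(x)$ are the limits of $M(z)$ as $z\to x$ from the upper ($+$) or lower ($-$) half-plane, $J_M(x)=\begin{pmatrix}0&1\\-1&0\end{pmatrix}$ for $x\in(a_k,b_k)$, $k=1,\dots,N$, and $J_M(x)=\begin{pmatrix}e^{-2\pi i n\alpha_k}&0\\0&e^{2\pi i n\alpha_k}\end{pmatrix}$ for $x\in(b_k,a_{k+1})$, $k=1,\dots,N-1$; (c) $M(z)=I+O(1/z)$ as $z\to\infty$; (d) $M$ has at most fourth-root singularities near the endpoints, i.e. its entries are $O(|z-c|^{-1/4})$ as $z\to c$ for every $c\in\{a_1,b_1,\dots,a_N,b_N\}$.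 This problem has a unique solution, and $\det M(z)=1$ for all $z\in\mathbb C\setminus[a_1,b_N]$, so $M(z)^{-1}$ exists. *)

theory Defs
  imports "HOL-Complex_Analysis.Complex_Analysis" "HOL-Library.Landau_Symbols"
begin

text \<open>Endpoints and parameters are sequences \<open>a, b, \<theta> :: nat \<Rightarrow> real\<close> of which only the entries
  \<open>a k, b k\<close> with \<open>1 \<le> k \<le> N\<close> and \<open>\<theta> k\<close> with \<open>1 \<le> k < N\<close> are used.\<close>

definition rhp_cut :: "nat \<Rightarrow> (nat \<Rightarrow> real) \<Rightarrow> (nat \<Rightarrow> real) \<Rightarrow> complex set" where
  "rhp_cut N a b = complex_of_real ` {a 1..b N}"

definition band_jump :: "complex ^ 2 ^ 2" where
  "band_jump = vector [vector [0, 1], vector [-1, 0]]"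

definition gap_jump :: "real \<Rightarrow> complex ^ 2 ^ 2" where
  "gap_jump t = vector [vector [exp (- 2 * of_real pi * \<i> * of_real t), 0],
                        vector [0, exp (2 * of_real pi * \<i> * of_real t)]]"

text \<open>Both one-sided limits of \<open>M\<close> at the real point \<open>x\<close> exist, and \<open>M\<^sub>+(x) = M\<^sub>-(x) J\<close>.\<close>

definition has_jump_at :: "(complex \<Rightarrow> complex ^ 2 ^ 2) \<Rightarrow> complex ^ 2 ^ 2 \<Rightarrow> real \<Rightarrow> bool" where
  "has_jump_at M J x \<longleftrightarrow>
     (\<exists>Mp Mm. (M \<longlongrightarrow> Mp) (at (of_real x) within {z. Im z > 0}) \<and>
              (M \<longlongrightarrow> Mm) (at (of_real x) within {z. Im z < 0}) \<and>
              Mp = Mm ** J)"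

text \<open>\<open>M\<close> is a total function, but its values on the cut are irrelevant. In the problem for a
  given \<open>n\<close> one takes \<open>\<theta> k = n \<alpha>\<^sub>k\<close>.\<close>

definition solves_model_RHP ::
  "nat \<Rightarrow> (nat \<Rightarrow> real) \<Rightarrow> (nat \<Rightarrow> real) \<Rightarrow> (nat \<Rightarrow> real) \<Rightarrow> (complex \<Rightarrow> complex ^ 2 ^ 2) \<Rightarrow> bool"
where
  "solves_model_RHP N a b \<theta> M \<longleftrightarrow>
     (\<forall>i j. (\<lambda>z. M z $ i $ j) analytic_on (- rhp_cut N a b)) \<and>
     (\<forall>k\<in>{1..N}. \<forall>x\<in>{a k<..<b k}. has_jump_at M band_jump x) \<and>
     (\<forall>k\<in>{1..<N}. \<forall>x\<in>{b k<..<a (Suc k)}. has_jump_at M (gap_jump (\<theta> k)) x) \<and>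
     (\<forall>i j. (\<lambda>z. (M z - mat 1) $ i $ j) \<in> O[at_infinity](\<lambda>z. 1 / z)) \<and>
     (\<forall>c \<in> a ` {1..N} \<union> b ` {1..N}. \<forall>i j.
        (\<lambda>z. norm (M z $ i $ j))
          \<in> O[at (of_real c) within (- rhp_cut N a b)](\<lambda>z. norm (z - of_real c) powr (- 1 / 4)))"

end

theory Submission
  imports Defs
begin

text \<open>
  Let \<open>(f, g)\<close> be a row of a solution, normalised so that \<open>f \<rightarrow> 1\<close> and \<open>g = O(1/z)\<close> (the second row is
  brought to this form by passing to \<open>(M\<^sub>2\<^sub>2, -M\<^sub>2\<^sub>1)\<close>).  Put \<open>S(z) = f(z) g*(z) - g(z) f*(z)\<close>, where \<open>f*(z)\<close> is
  the conjugate of \<open>f\<close> at the conjugate of \<open>z\<close>.  The phases on the gaps are unimodular and cancel in \<open>S\<close>,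
  and on the bands \<open>S\<close> changes sign with \<open>S\<^sub>+ = - (|f\<^sub>+|\<^sup>2 + |g\<^sub>+|\<^sup>2)\<close>.  Hence \<open>P = S sqrt (\<Prod>\<^sub>k (z - a\<^sub>k) (z - b\<^sub>k))\<close>
  is a polynomial of degree less than \<open>N\<close>, and up to a constant phase its signs on the \<open>N\<close> bands
  alternate.  By Lagrange interpolation with one node in each band, the modulus \<open>\<gamma>\<close> of its leading
  coefficient controls \<open>P\<close>, and thus \<open>|f|\<^sup>2\<close> and \<open>|g|\<^sup>2\<close>, on the bands.

  The moduli of \<open>f\<close> and \<open>g\<close> are single valued off the bands, so the maximum principle, applied after
  multiplication by a fixed function vanishing at the endpoints, gives \<open>f, g = O(sqrt \<gamma>)\<close> away from the
  endpoints when \<open>\<gamma> \<ge> 1\<close>.  Near infinity the Schwarz lemma improves this to \<open>f - 1, g = O(sqrt \<gamma> / z)\<close>;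
  comparing with \<open>|S| \<approx> \<gamma> / |z|\<close> bounds \<open>\<gamma>\<close>.  No constant depends on the phases.
\<close>

subsection \<open>One-sided limits, gluing and maximum principles\<close>

text \<open>The gap phases vary with \<open>n\<close> without any pattern, so the estimate may see
  them only through their modulus. Pairing a row with its own Schwarz reflection achieves this,
  since conjugating a unimodular factor inverts it, and it keeps positivity: on a band the pairing
  is a sum of two squared moduli, so a bound for the polynomial bounds \<open>f\<close> and
  \<open>g\<close> separately. The degree stays below \<open>N\<close> because
  \<open>S = O(1/z)\<close> meets a root that grows like the \<open>N\<close>-th power of
  \<open>z\<close>; a polynomial of that degree is determined by one value per band. The alternating
  signs are exactly those of the Lagrange denominators, so the leading coefficient is a sum without
  cancellation and each value on a band is dominated by it. The root cannot itself serve as the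
  multiplier in the maximum principle, as it is unbounded at infinity; a bounded function with the
  same order of vanishing at the endpoints replaces it.\<close>

abbreviation up :: "real \<Rightarrow> complex filter" where
  "up x \<equiv> at (complex_of_real x) within {z. Im z > 0}"

abbreviation dn :: "real \<Rightarrow> complex filter" where
  "dn x \<equiv> at (complex_of_real x) within {z. Im z < 0}"

lemma up_neq_bot [simp]: "up x \<noteq> bot"
proof -
  have "complex_of_real x islimpt {z. Im z > 0}"
    unfolding islimpt_approachable
  proof (intro allI impI)
    fix e :: real assume "e > 0"
    then show "\<exists>z\<in>{z. Im z > 0}. z \<noteq> complex_of_real x \<and> dist z (complex_of_real x) < e"
      by (intro bexI[of _ "Complex x (e/2)"]) (auto simp: dist_norm complex_eq_iff cmod_def)
  qed
  then show ?thesis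
    by (simp add: trivial_limit_within)
qed

lemma filterlim_cnj_up: "filterlim cnj (dn x) (up x)"
  and filterlim_cnj_dn: "filterlim cnj (up x) (dn x)"
proof -
  have 1: "(cnj \<longlongrightarrow> complex_of_real x) (at (of_real x) within S)" for S
    using tendsto_cnj[OF tendsto_ident_at, of "complex_of_real x" S] by simp
  show "filterlim cnj (dn x) (up x)"
    unfolding filterlim_at using 1
    by (auto simp: eventually_at_topological complex_eq_iff)
  show "filterlim cnj (up x) (dn x)"
    unfolding filterlim_at using 1
    by (auto simp: eventually_at_topological complex_eq_iff)
qed

lemma tendsto_reflect_up: "(f \<longlongrightarrow> L) (dn x) \<Longrightarrow> ((\<lambda>z. cnj (f (cnj z))) \<longlongrightarrow> cnj L) (up x)"
  and tendsto_reflect_dn: "(f \<longlongrightarrow> L) (up x) \<Longrightarrow> ((\<lambda>z. cnj (f (cnj z))) \<longlongrightarrow> cnj L) (dn x)"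
  by (auto intro!: tendsto_cnj filterlim_compose[OF _ filterlim_cnj_up]
      filterlim_compose[OF _ filterlim_cnj_dn])

lemma up_le_at: "up x \<le> at (of_real x)" and dn_le_at: "dn x \<le> at (of_real x)"
  by (auto intro: at_le)

lemma eventually_up_Im: "eventually (\<lambda>z. Im z > 0) (up x)"
  by (auto simp: eventually_at_topological)

lemma eventually_dn_Im: "eventually (\<lambda>z. Im z < 0) (dn x)"
  by (auto simp: eventually_at_topological)

lemma eventually_up_ball:
  assumes "eventually Q (up x)"
  obtains d where "d > 0" "\<And>z. z \<in> ball (of_real x) d \<Longrightarrow> Im z > 0 \<Longrightarrow> Q z"
proof -
  obtain d where d: "d > 0" "\<forall>z\<in>{z. Im z > 0}. z \<noteq> of_real x \<and> dist z (of_real x) < d \<longrightarrow> Q z"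
    using assms unfolding eventually_at by blast
  show ?thesis
    by (rule that[OF d(1)]) (use d(2) in \<open>auto simp: dist_commute\<close>)
qed

lemma eventually_dn_ball:
  assumes "eventually Q (dn x)"
  obtains d where "d > 0" "\<And>z. z \<in> ball (of_real x) d \<Longrightarrow> Im z < 0 \<Longrightarrow> Q z"
proof -
  obtain d where d: "d > 0" "\<forall>z\<in>{z. Im z < 0}. z \<noteq> of_real x \<and> dist z (of_real x) < d \<longrightarrow> Q z"
    using assms unfolding eventually_at by blast
  show ?thesis
    by (rule that[OF d(1)]) (use d(2) in \<open>auto simp: dist_commute\<close>)
qed

text \<open>A pointwise form of Painleve's theorem. Continuity of the boundary values need not be
  assumed: each of them is a limit of values of \<open>g\<close> at nearby nonreal points, and this
  makes the extension by upper limits continuous. A continuous function that is holomorphic on both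
  sides of a line is holomorphic across it.\<close>

lemma holomorphic_glue_real_line:
  assumes S: "open S" and g: "g holomorphic_on (S - \<real>)"
    and lim: "\<And>x. of_real x \<in> S \<Longrightarrow> \<exists>L. (g \<longlongrightarrow> L) (up x) \<and> (g \<longlongrightarrow> L) (dn x)"
  obtains h where "h holomorphic_on S" "\<And>z. z \<in> S \<Longrightarrow> Im z \<noteq> 0 \<Longrightarrow> h z = g z"
proof
  define h where "h z = (if Im z = 0 then Lim (up (Re z)) g else g z)" for z
  have h_real: "h (of_real x) = L" if "(g \<longlongrightarrow> L) (up x)" for x L
    using that by (simp add: h_def tendsto_Lim)
  have RI: "z \<in> \<real> \<longleftrightarrow> Im z = 0" for z :: complex
    by (simp add: complex_is_Real_iff)
  have openR: "open (S - \<real>)"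
    using S by (simp add: open_Diff closed_complex_Reals)
  have hol': "h holomorphic_on (S - \<real>)"
    by (rule holomorphic_transform[OF g]) (auto simp: h_def RI)
  have cont: "continuous (at z) h" if z: "z \<in> S" for z
  proof (cases "z \<in> \<real>")
    case False
    then show ?thesis
      using hol' openR z continuous_on_eq_continuous_at holomorphic_on_imp_continuous_on
      by (metis DiffI)
  next
    case True
    then obtain x where x: "z = of_real x" by (auto elim: Reals_cases)
    with lim z obtain L where L: "(g \<longlongrightarrow> L) (up x)" "(g \<longlongrightarrow> L) (dn x)" by blast
    have "(h \<longlongrightarrow> L) (at z)"
    proof (rule tendstoI)
      fix e :: real assume e: "e > 0"
      obtain d1 where d1: "d1 > 0" "\<And>w. w \<in> ball (of_real x) d1 \<Longrightarrow> Im w > 0 \<Longrightarrow> dist (g w) L < e/2"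
        using tendstoD[OF L(1), of "e/2"] e by (auto elim: eventually_up_ball)
      obtain d2 where d2: "d2 > 0" "\<And>w. w \<in> ball (of_real x) d2 \<Longrightarrow> Im w < 0 \<Longrightarrow> dist (g w) L < e/2"
        using tendstoD[OF L(2), of "e/2"] e by (auto elim: eventually_dn_ball)
      obtain d3 where d3: "d3 > 0" "ball (of_real x) d3 \<subseteq> S"
        using S z x openE by blast
      define d where "d = min d1 (min d2 d3)"
      have d: "d > 0" using d1 d2 d3 by (simp add: d_def)
      have "dist (h w) L < e" if w: "w \<in> ball (of_real x) d" for w
      proof (cases "w \<in> \<real>")
        case False
        then show ?thesis
          using d1(2)[of w] d2(2)[of w] w e by (cases "Im w > 0") (auto simp: d_def h_def RI)
      next
        case True
        then obtain y where y: "w = of_real y" by (auto elim: Reals_cases)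
        have "of_real y \<in> S" using w y d3 by (auto simp: d_def)
        with lim obtain L' where L': "(g \<longlongrightarrow> L') (up y)" by blast
        have "eventually (\<lambda>v. v \<in> ball (of_real x) d) (up y)"
          using w y by (intro eventually_at_in_open'[THEN filter_leD[OF up_le_at]]) auto
        then have "eventually (\<lambda>v. dist (g v) L \<le> e/2) (up y)"
          using eventually_up_Im[of y]
          by eventually_elim (use d1(2) in \<open>force simp: d_def\<close>)
        \<comment> \<open>The strict bound on nonreal points survives the limit only as a weak one,
          hence the choice of \<open>e/2\<close> above.\<close>
        then have "dist L' L \<le> e/2"
          by (intro tendsto_upperbound[OF tendsto_dist[OF L' tendsto_const]]) auto
        then show ?thesis using e y h_real[OF L'] by simp
      qed
      then show "eventually (\<lambda>w. dist (h w) L < e) (at z)"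
        unfolding eventually_at using d x by (intro exI[of _ d]) (auto simp: dist_commute)
    qed
    then show ?thesis using h_real[OF L(1)] by (simp add: isCont_def x)
  qed
  have half: "h holomorphic_on (S \<inter> T)" if "T \<subseteq> - \<real>" for T
    using hol' by (rule holomorphic_on_subset) (use that in auto)
  show "h holomorphic_on S"
    by (rule holomorphic_on_paste_across_line[OF S, of \<i> _ 0])
      (auto intro!: half continuous_at_imp_continuous_on cont simp: RI inner_complex_def)
  show "h z = g z" if "z \<in> S" "Im z \<noteq> 0" for z
    using that by (simp add: h_def)
qed

text \<open>Riemann's removability theorem, applied to one point at a time. The hypothesis at the
  remaining points survives because the extension agrees with \<open>h\<close> on a punctured
  neighbourhood of each of them.\<close>

lemma holomorphic_remove_finite_singularities:
  assumes "finite F" "h holomorphic_on - F"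
    and "\<And>c. c \<in> F \<Longrightarrow> ((\<lambda>z. (z - c) * h z) \<longlongrightarrow> 0) (at c)"
  obtains k where "k holomorphic_on UNIV" "\<And>z. z \<notin> F \<Longrightarrow> k z = h z"
  using assms
proof (induction F arbitrary: thesis h rule: finite_induct)
  case empty
  then show ?case by auto
next
  case (insert c F)
  have op: "open (- F)" using insert.hyps by (simp add: finite_imp_closed open_Compl)
  have eq: "- insert c F = - F - {c}" by auto
  have "\<exists>g. g holomorphic_on - F \<and> (\<forall>z \<in> - F - {c}. g z = h z)"
    by (subst holomorphic_on_extend_lim)
      (use insert op eq in \<open>auto simp: interior_open\<close>)
  then obtain g where g: "g holomorphic_on - F" "\<And>z. z \<notin> F \<Longrightarrow> z \<noteq> c \<Longrightarrow> g z = h z"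
    by auto
  have lim: "((\<lambda>z. (z - c') * g z) \<longlongrightarrow> 0) (at c')" if c': "c' \<in> F" for c'
  proof (rule Lim_transform_eventually)
    show "((\<lambda>z. (z - c') * h z) \<longlongrightarrow> 0) (at c')" using insert.prems c' by auto
    have "open (- insert c (F - {c'}))"
      using insert.hyps by (intro open_Compl finite_imp_closed) auto
    moreover have "c' \<in> - insert c (F - {c'})" using c' insert.hyps by auto
    ultimately have "eventually (\<lambda>z. z \<in> - insert c (F - {c'}) - {c'}) (at c')"
      by (rule eventually_at_in_open)
    then show "\<forall>\<^sub>F z in at c'. (z - c') * h z = (z - c') * g z"
      by eventually_elim (use g in auto)
  qed
  obtain k where "k holomorphic_on UNIV" "\<And>z. z \<notin> F \<Longrightarrow> k z = g z"
    using insert.IH[OF _ g(1) lim] by auto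
  then show ?case using insert.prems(1) g(2) by auto
qed

text \<open>Only \<open>v\<close>, and not a holomorphic function with modulus \<open>v\<close>, need be globally defined;
  \<open>D\<close> may be unbounded.\<close>

lemma maximum_principle_local_modulus:
  fixes v :: "complex \<Rightarrow> real"
  assumes D: "open D"
    and loc: "\<And>z. z \<in> D \<Longrightarrow> \<exists>e>0. \<exists>g. ball z e \<subseteq> D \<and> g holomorphic_on ball z e \<and>
                (\<forall>w\<in>ball z e. norm (g w) = v w)"
    and bd: "\<And>p K'. p \<notin> D \<Longrightarrow> K < K' \<Longrightarrow> eventually (\<lambda>z. v z < K') (at p within D)"
    and inf: "\<And>K'. K < K' \<Longrightarrow> eventually (\<lambda>z. z \<in> D \<longrightarrow> v z < K') at_infinity"
    and z: "z \<in> D"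
  shows "v z \<le> K"
proof (rule ccontr)
  assume "\<not> v z \<le> K"
  then have K: "K < v z" by simp
  have contv: "isCont v w" if "w \<in> D" for w
  proof -
    obtain e g where e: "e > 0" "g holomorphic_on ball w e" "\<forall>u\<in>ball w e. norm (g u) = v u"
      using loc[OF \<open>w \<in> D\<close>] by blast
    have "continuous_on (ball w e) (\<lambda>u. norm (g u))"
      using e holomorphic_on_imp_continuous_on continuous_on_norm by blast
    then have "continuous_on (ball w e) v"
      by (rule continuous_on_eq) (use e in auto)
    then show ?thesis using e(1) by (simp add: continuous_on_eq_continuous_at)
  qed
  \<comment> \<open>The hypotheses at points outside \<open>D\<close> and at infinity, used at the
    level \<open>v z > K\<close>, make this superlevel set compact although \<open>D\<close> may be
    unbounded, so \<open>v\<close> attains its maximum over \<open>D\<close> on it.\<close>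
  define A where "A = {w\<in>D. v w \<ge> v z}"
  have "closed A"
    unfolding closed_limpt
  proof (intro allI impI)
    fix p assume p: "p islimpt A"
    then have nb: "at p within A \<noteq> bot" by (simp add: trivial_limit_within)
    have "p \<in> D"
    proof (rule ccontr)
      assume "p \<notin> D"
      then have "eventually (\<lambda>w. v w < v z) (at p within D)" using bd K by blast
      then have "eventually (\<lambda>w. v w < v z) (at p within A)"
        by (rule filter_leD[OF at_le, rotated]) (auto simp: A_def)
      moreover have "eventually (\<lambda>w. w \<in> A) (at p within A)"
        by (auto simp: eventually_at_topological)
      ultimately have "eventually (\<lambda>w. False) (at p within A)"
        by eventually_elim (auto simp: A_def)
      then show False using nb by simp
    qed
    moreover have "v z \<le> v p"
    proof (rule tendsto_lowerbound[OF _ _ nb])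
      show "(v \<longlongrightarrow> v p) (at p within A)"
        using contv[OF \<open>p \<in> D\<close>] by (simp add: isCont_def tendsto_within_subset[of _ _ _ UNIV])
      show "eventually (\<lambda>w. v z \<le> v w) (at p within A)"
        by (auto simp: eventually_at_topological A_def)
    qed
    ultimately show "p \<in> A" by (simp add: A_def)
  qed
  moreover have "bounded A"
  proof -
    obtain B where "\<And>w. norm w \<ge> B \<Longrightarrow> w \<in> D \<Longrightarrow> v w < v z"
      using inf[OF K] unfolding eventually_at_infinity by blast
    then have "norm w \<le> B" if "w \<in> A" for w
      using that by (force simp: A_def)
    then show ?thesis by (auto simp: bounded_iff)
  qed
  ultimately have cA: "compact A" by (simp add: compact_eq_bounded_closed)
  have "z \<in> A" using \<open>z \<in> D\<close> by (simp add: A_def)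
  have conA: "continuous_on A v"
    using contv by (auto simp: A_def intro: continuous_at_imp_continuous_on)
  obtain w0 where w0: "w0 \<in> A" "\<And>w. w \<in> A \<Longrightarrow> v w \<le> v w0"
    using continuous_attains_sup[OF cA _ conA] \<open>z \<in> A\<close> by blast
  have max: "v w \<le> v w0" if "w \<in> D" for w
    using w0(2)[of w] w0(1) that by (cases "w \<in> A") (auto simp: A_def)
  \<comment> \<open>The maximum modulus principle makes the set of maximum points open. It is also
    compact and nonempty, which is impossible in the connected unbounded plane.\<close>
  define T where "T = {w\<in>A. v w = v w0}"
  have "compact T"
  proof -
    have "closedin (top_of_set A) T"
      unfolding T_def by (rule continuous_closedin_preimage_constant[OF conA])
    then show ?thesis using closedin_compact cA by blast
  qed
  moreover have "open T"
    unfolding open_contains_ball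
  proof
    fix t assume t: "t \<in> T"
    then have "t \<in> D" by (auto simp: T_def A_def)
    then obtain e g where e: "e > 0" "ball t e \<subseteq> D" "g holomorphic_on ball t e"
        "\<forall>u\<in>ball t e. norm (g u) = v u"
      using loc by blast
    have "g constant_on ball t e"
    proof (rule maximum_modulus_principle[OF e(3), of "ball t e" t])
      show "cmod (g u) \<le> cmod (g t)" if "u \<in> ball t e" for u
        using e that max[of u] t by (auto simp: T_def)
    qed (use e in auto)
    then obtain y where y: "\<forall>u\<in>ball t e. g u = y" unfolding constant_on_def by blast
    have vy: "v u = norm y" if "u \<in> ball t e" for u
    proof -
      have "v u = norm (g u)" using bspec[OF e(4) that] by (rule sym)
      also have "g u = y" using y that by (rule bspec)
      finally show ?thesis .
    qed
    have "v u = v t" if "u \<in> ball t e" for u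
      unfolding vy[OF that] by (rule vy[symmetric]) (use e(1) in simp)
    then have "u \<in> T" if "u \<in> ball t e" for u
      using that t subsetD[OF e(2) that] unfolding T_def A_def by simp
    then have "ball t e \<subseteq> T" by (rule subsetI)
    then show "\<exists>e>0. ball t e \<subseteq> T" using e by blast
  qed
  moreover have "T \<noteq> {}" using w0 by (auto simp: T_def)
  ultimately have "T = UNIV" "bounded T"
    by (metis clopen compact_imp_closed) (rule compact_imp_bounded[OF \<open>compact T\<close>])
  then show False by simp
qed

text \<open>The Schwarz lemma for \<open>g (\<rho> / w) / B\<close> on the unit disc; the limit
  \<open>0\<close> at infinity fills in the value at \<open>w = 0\<close>.\<close>

lemma Schwarz_at_infinity:
  assumes hol: "g holomorphic_on {z. norm z > \<rho>}" and \<rho>: "\<rho> > 0"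
    and lim: "(g \<longlongrightarrow> 0) at_infinity"
    and bound: "\<And>z. norm z > \<rho> \<Longrightarrow> norm (g z) < B"
    and z: "norm z > \<rho>"
  shows "norm (g z) \<le> B * \<rho> / norm z"
proof -
  have B: "B > 0" using bound[OF z] norm_ge_zero[of "g z"] by linarith
  define \<phi> where "\<phi> w = (if w = 0 then 0 else g (of_real \<rho> / w) / of_real B)" for w
  have dom: "norm (of_real \<rho> / w) > \<rho>" if "w \<in> ball 0 1 - {0}" for w :: complex
    using that \<rho> by (simp add: norm_divide field_simps)
  have hol1: "\<phi> holomorphic_on ball 0 1 - {0}"
  proof (rule holomorphic_transform)
    have "(g \<circ> (\<lambda>w. of_real \<rho> / w)) holomorphic_on ball 0 1 - {0}"
      by (rule holomorphic_on_compose_gen[OF _ hol])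
        (use dom in \<open>auto intro!: holomorphic_intros\<close>)
    then show "(\<lambda>w. g (of_real \<rho> / w) / of_real B) holomorphic_on ball 0 1 - {0}"
      using B by (intro holomorphic_intros) (auto simp: o_def)
  qed (auto simp: \<phi>_def)
  have lim0: "(\<phi> \<longlongrightarrow> 0) (at 0)"
  proof (rule Lim_transform_eventually)
    have "filterlim (\<lambda>w. of_real \<rho> / w) at_infinity (at (0::complex))"
      using \<rho> by (intro filterlim_divide_at_infinity[OF tendsto_const])
        (auto simp: filterlim_at eventually_at_filter)
    then have "((\<lambda>w. g (of_real \<rho> / w) / of_real B) \<longlongrightarrow> 0 / of_real B) (at 0)"
      using B by (intro tendsto_divide filterlim_compose[OF lim]) auto
    then show "((\<lambda>w. g (of_real \<rho> / w) / of_real B) \<longlongrightarrow> 0) (at 0)" by simp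
    show "\<forall>\<^sub>F w in at 0. g (of_real \<rho> / w) / of_real B = \<phi> w"
      by (auto simp: \<phi>_def eventually_at_filter)
  qed
  have hol\<phi>: "\<phi> holomorphic_on ball 0 1"
  proof (rule no_isolated_singularity[OF _ hol1])
    have "isCont \<phi> w" if "w \<in> ball 0 1" for w
    proof (cases "w = 0")
      case True
      then show ?thesis using lim0 by (simp add: isCont_def \<phi>_def)
    next
      case False
      then show ?thesis
        using hol1 that by (metis DiffI continuous_on_eq_continuous_at
          holomorphic_on_imp_continuous_on open_ball open_delete singletonD)
    qed
    then show "continuous_on (ball 0 1) \<phi>" by (simp add: continuous_at_imp_continuous_on)
  qed auto
  have b: "norm (\<phi> w) < 1" if "norm w < 1" for w
    using bound[OF dom[of w]] that B by (auto simp: \<phi>_def norm_divide)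
  have nz: "z \<noteq> 0" using z \<rho> by auto
  have "norm (\<phi> (of_real \<rho> / z)) \<le> norm (of_real \<rho> / z)"
    by (rule Schwarz_Lemma(1)[OF hol\<phi> _ b]) (use z \<rho> nz in \<open>auto simp: \<phi>_def norm_divide\<close>)
  then show ?thesis using B \<rho> nz by (simp add: \<phi>_def norm_divide field_simps)
qed

subsection \<open>A single band\<close>

text \<open>The case \<open>u = 0\<close>, where the quotient is \<open>0\<close>, is included so
  that \<open>norm_band_root\<close> holds at the endpoint \<open>\<alpha>\<close> too.\<close>

lemma mult_sqrt_divide:
  fixes u w :: real
  assumes "u \<ge> 0"
  shows "u * sqrt (w / u) = sqrt (u * w)"
proof (cases "u = 0")
  case False
  then have "sqrt (u * w) = sqrt (u\<^sup>2 * (w / u))" by (simp add: power2_eq_square)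
  also have "\<dots> = u * sqrt (w / u)" using assms by (simp only: real_sqrt_mult real_sqrt_pow2 real_sqrt_abs abs_of_nonneg)
  finally show ?thesis by simp
qed simp

text \<open>Solving (z - \<beta>) / (z - \<alpha>) = t for t \<le> 0 gives z = (\<beta> - t
  \<alpha>) / (1 - t), a convex combination of the endpoints. Hence the cut of the principal square
  root lies over the band.\<close>

lemma ratio_nonpos_imp_segment:
  fixes \<alpha> \<beta> :: real
  assumes "\<alpha> < \<beta>" "z \<notin> complex_of_real ` {\<alpha>..\<beta>}"
  shows "(z - of_real \<beta>) / (z - of_real \<alpha>) \<notin> \<real>\<^sub>\<le>\<^sub>0"
proof
  assume "(z - of_real \<beta>) / (z - of_real \<alpha>) \<in> \<real>\<^sub>\<le>\<^sub>0"
  then obtain t where t: "t \<le> 0" "(z - of_real \<beta>) / (z - of_real \<alpha>) = of_real t"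
    by (auto elim: nonpos_Reals_cases)
  have za: "z \<noteq> of_real \<alpha>" using assms by auto
  with t have "z * of_real (1 - t) = of_real (\<beta> - t * \<alpha>)"
    by (simp add: field_simps)
  moreover have "complex_of_real (1 - t) \<noteq> 0" using t(1) by (simp only: of_real_eq_0_iff)
  ultimately have "z = of_real (\<beta> - t * \<alpha>) / of_real (1 - t)" by (simp add: eq_divide_eq)
  also have "\<dots> = of_real ((\<beta> - t * \<alpha>) / (1 - t))" by simp
  finally have "z = of_real ((\<beta> - t * \<alpha>) / (1 - t))" .
  moreover have "\<alpha> \<le> (\<beta> - t * \<alpha>) / (1 - t)" using t(1) assms(1)
    by (simp add: field_simps)
  moreover have "(\<beta> - t * \<alpha>) / (1 - t) \<le> \<beta>" using t(1) assms(1) mult_left_mono_neg[of \<alpha> \<beta> t]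
    by (simp add: field_simps)
  ultimately show False using assms(2) by (metis atLeastAtMost_iff imageI)
qed

text \<open>\<open>band_ratio \<alpha> \<beta>\<close> maps the complement of \<open>[\<alpha>, \<beta>]\<close> to the right half-plane and \<open>\<infinity>\<close> to \<open>1\<close>;
  \<open>band_root \<alpha> \<beta>\<close> is the branch of \<open>sqrt ((z - \<alpha>) (z - \<beta>))\<close> asymptotic to \<open>z\<close>.\<close>

definition band_ratio :: "real \<Rightarrow> real \<Rightarrow> complex \<Rightarrow> complex" where
  "band_ratio \<alpha> \<beta> z = csqrt ((z - of_real \<beta>) / (z - of_real \<alpha>))"

definition band_root :: "real \<Rightarrow> real \<Rightarrow> complex \<Rightarrow> complex" where
  "band_root \<alpha> \<beta> z = (z - of_real \<alpha>) * band_ratio \<alpha> \<beta> z"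

text \<open>A bounded substitute for \<open>band_root\<close>. With r the ratio and p, q the
  distances to the endpoints, r / (1 + r)^2 has modulus comparable to sqrt (p q) / (p + q): it
  vanishes like a square root at both endpoints and tends to 1/4 at infinity. The denominator has no
  zero because Re r \<ge> 0.\<close>

definition band_damp :: "real \<Rightarrow> real \<Rightarrow> complex \<Rightarrow> complex" where
  "band_damp \<alpha> \<beta> z = band_ratio \<alpha> \<beta> z / (1 + band_ratio \<alpha> \<beta> z)\<^sup>2"

lemma Re_band_ratio: "Re (band_ratio \<alpha> \<beta> z) \<ge> 0"
  using csqrt_principal[of "(z - of_real \<beta>) / (z - of_real \<alpha>)"]
  unfolding band_ratio_def by linarith

lemma band_ratio_holomorphic [holomorphic_intros]:
  assumes "\<alpha> < \<beta>"
  shows "band_ratio \<alpha> \<beta> holomorphic_on - complex_of_real ` {\<alpha>..\<beta>}"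
  unfolding band_ratio_def
  using assms ratio_nonpos_imp_segment[OF assms]
  by (intro holomorphic_intros) (auto intro: image_eqI[of _ _ \<alpha>])

lemma band_root_holomorphic:
  assumes "\<alpha> < \<beta>"
  shows "band_root \<alpha> \<beta> holomorphic_on - complex_of_real ` {\<alpha>..\<beta>}"
  unfolding band_root_def by (intro holomorphic_intros assms)

lemma one_plus_band_ratio_neq_0: "1 + band_ratio \<alpha> \<beta> z \<noteq> 0"
  using Re_band_ratio[of \<alpha> \<beta> z] by (auto simp: complex_eq_iff)

lemma band_damp_holomorphic:
  assumes "\<alpha> < \<beta>"
  shows "band_damp \<alpha> \<beta> holomorphic_on - complex_of_real ` {\<alpha>..\<beta>}"
  unfolding band_damp_def
  by (intro holomorphic_intros assms) (auto simp: one_plus_band_ratio_neq_0)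

lemma norm_band_root:
  "norm (band_root \<alpha> \<beta> z) = sqrt (norm (z - of_real \<alpha>) * norm (z - of_real \<beta>))"
  by (simp add: band_root_def band_ratio_def norm_mult norm_csqrt norm_divide mult_sqrt_divide)

text \<open>With t the modulus of the ratio, sqrt (p q) / (p + q) equals t / (1 + t^2). Moreover |1
  + r|^2 = 1 + 2 Re r + t^2 lies between 1 + t^2 and 2 (1 + t^2), because 0 \<le> Re r \<le> t and 2
  t \<le> 1 + t^2.\<close>

lemma norm_band_damp_bounds:
  fixes \<alpha> \<beta> :: real and z :: complex
  defines "p \<equiv> norm (z - complex_of_real \<alpha>)" and "q \<equiv> norm (z - complex_of_real \<beta>)"
  shows "norm (band_damp \<alpha> \<beta> z) \<le> sqrt (p * q) / (p + q)"
    and "norm (band_damp \<alpha> \<beta> z) \<ge> sqrt (p * q) / (2 * (p + q))"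
proof -
  define s where "s = band_ratio \<alpha> \<beta> z"
  define t where "t = norm s"
  have *: "sqrt (p * q) / (p + q) = t / (1 + t\<^sup>2)"
  proof (cases "p = 0")
    case True
    then show ?thesis by (simp add: t_def s_def p_def band_ratio_def)
  next
    case False
    then have p: "p > 0" by (simp add: p_def)
    have q: "q \<ge> 0" by (simp add: q_def)
    have t: "t = sqrt (q / p)"
      by (simp add: t_def s_def band_ratio_def p_def q_def norm_divide norm_csqrt)
    then have "t\<^sup>2 = q / p" using p q by simp
    moreover have "sqrt (p * q) = p * t"
      using p by (simp add: t mult_sqrt_divide)
    moreover have "p + q = p * (1 + q / p)" using p by (simp add: field_simps)
    ultimately show ?thesis using p by simp
  qed
  have n: "norm (1 + s) ^ 2 = 1 + 2 * Re s + t\<^sup>2"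
    unfolding t_def cmod_power2 by (simp add: power2_eq_square algebra_simps)
  have lo: "1 + t\<^sup>2 \<le> norm (1 + s) ^ 2"
    using n Re_band_ratio[of \<alpha> \<beta> z] by (simp add: s_def)
  have hi: "norm (1 + s) ^ 2 \<le> 2 * (1 + t\<^sup>2)"
  proof -
    have "Re s \<le> t" unfolding t_def by (rule complex_Re_le_cmod)
    moreover have "2 * t \<le> 1 + t\<^sup>2" using sum_squares_bound[of t 1] by simp
    ultimately show ?thesis using n by simp
  qed
  have d: "norm (band_damp \<alpha> \<beta> z) = t / norm (1 + s) ^ 2"
    by (simp add: band_damp_def s_def t_def norm_divide norm_power)
  have t0: "t \<ge> 0" "1 + t\<^sup>2 > 0" by (simp_all add: t_def add_pos_nonneg)
  show "norm (band_damp \<alpha> \<beta> z) \<le> sqrt (p * q) / (p + q)"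
    unfolding * d using lo t0 by (intro divide_left_mono mult_pos_pos) linarith+
  have "t / (2 * (1 + t\<^sup>2)) \<le> t / norm (1 + s) ^ 2"
    using hi lo t0 by (intro divide_left_mono mult_pos_pos) linarith+
  then show "norm (band_damp \<alpha> \<beta> z) \<ge> sqrt (p * q) / (2 * (p + q))"
    unfolding d using arg_cong[OF *, of "\<lambda>u. u / 2"] by (simp add: mult.commute)
qed

lemma dist_ge_band_length:
  fixes \<alpha> \<beta> :: real
  assumes "\<alpha> < \<beta>"
  shows "\<beta> - \<alpha> \<le> norm (z - complex_of_real \<alpha>) + norm (z - complex_of_real \<beta>)"
proof -
  have "norm (complex_of_real \<beta> - of_real \<alpha>) = \<beta> - \<alpha>"
    using assms by (metis abs_of_pos diff_gt_0_iff_gt norm_of_real of_real_diff)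
  then show ?thesis
    using norm_triangle_ineq4[of "z - of_real \<alpha>" "z - of_real \<beta>"] by simp
qed

lemma norm_band_damp_le_root:
  assumes "\<alpha> < \<beta>"
  shows "norm (band_damp \<alpha> \<beta> z) \<le> norm (band_root \<alpha> \<beta> z) / (\<beta> - \<alpha>)"
proof -
  have "norm (band_root \<alpha> \<beta> z) / (norm (z - complex_of_real \<alpha>) + norm (z - complex_of_real \<beta>))
      \<le> norm (band_root \<alpha> \<beta> z) / (\<beta> - \<alpha>)"
    using dist_ge_band_length[OF assms, of z] assms by (intro divide_left_mono) auto
  then show ?thesis
    using norm_band_damp_bounds(1)[of \<alpha> \<beta> z] by (simp add: norm_band_root)
qed

lemma norm_band_damp_le_1: "norm (band_damp \<alpha> \<beta> z) \<le> 1"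
proof -
  define p q where "p = norm (z - complex_of_real \<alpha>)" and "q = norm (z - complex_of_real \<beta>)"
  have pq: "p \<ge> 0" "q \<ge> 0" by (simp_all add: p_def q_def)
  have "sqrt (p * q) \<le> p + q"
    by (rule real_le_lsqrt) (use pq in \<open>auto simp: power2_eq_square algebra_simps\<close>)
  then have "sqrt (p * q) / (p + q) \<le> 1" using pq by (simp add: divide_le_eq)
  then show ?thesis using norm_band_damp_bounds(1)[of \<alpha> \<beta> z] by (simp add: p_def q_def)
qed

lemma norm_band_damp_ge:
  fixes \<alpha> \<beta> \<epsilon> :: real
  assumes "\<alpha> < \<beta>" "\<epsilon> > 0" "norm (z - complex_of_real \<alpha>) \<ge> \<epsilon>" "norm (z - complex_of_real \<beta>) \<ge> \<epsilon>"
  shows "norm (band_damp \<alpha> \<beta> z) \<ge> \<epsilon> / (2 * (2 * \<epsilon> + (\<beta> - \<alpha>)))"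
proof -
  define p q where "p = norm (z - complex_of_real \<alpha>)" and "q = norm (z - complex_of_real \<beta>)"
  have n: "norm (complex_of_real \<beta> - of_real \<alpha>) = \<beta> - \<alpha>"
    using assms by (metis abs_of_pos diff_gt_0_iff_gt norm_of_real of_real_diff)
  have qp: "q \<le> p + (\<beta> - \<alpha>)" "p \<le> q + (\<beta> - \<alpha>)"
    using norm_triangle_ineq4[of "z - complex_of_real \<alpha>" "of_real \<beta> - complex_of_real \<alpha>"]
      norm_triangle_ineq[of "z - complex_of_real \<beta>" "complex_of_real \<beta> - complex_of_real \<alpha>"] n
    by (simp_all add: p_def q_def)
  \<comment> \<open>Here u is the smaller and v the larger distance: sqrt (u v) \<ge> u, the sum is
    at most 2 u + (\<beta> - \<alpha>), and the resulting quotient increases with u, so u may be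
    replaced by \<epsilon>.\<close>
  have aux: "\<epsilon> / (2 * (2 * \<epsilon> + (\<beta> - \<alpha>))) \<le> sqrt (u * v) / (2 * (u + v))"
    if "u \<ge> \<epsilon>" "v \<ge> u" "v \<le> u + (\<beta> - \<alpha>)" for u v
  proof -
    have "u = sqrt (u * u)" using that assms by simp
    also have "\<dots> \<le> sqrt (u * v)" using that assms by (intro real_sqrt_le_mono mult_left_mono) auto
    finally have 1: "u \<le> sqrt (u * v)" .
    have "\<epsilon> / (2 * (2 * \<epsilon> + (\<beta> - \<alpha>))) \<le> u / (2 * (2 * u + (\<beta> - \<alpha>)))"
      using that assms mult_right_mono[of \<epsilon> u "\<beta> - \<alpha>"] by (simp add: field_simps)
    also have "\<dots> \<le> u / (2 * (u + v))"
      using that assms by (intro divide_left_mono) auto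
    also have "\<dots> \<le> sqrt (u * v) / (2 * (u + v))"
      using that assms 1 by (intro divide_right_mono) auto
    finally show ?thesis .
  qed
  have "\<epsilon> / (2 * (2 * \<epsilon> + (\<beta> - \<alpha>))) \<le> sqrt (p * q) / (2 * (p + q))"
  proof (cases "p \<le> q")
    case True
    then show ?thesis using aux[of p q] qp assms by (simp add: p_def)
  next
    case False
    then show ?thesis using aux[of q p] qp assms by (simp add: q_def mult.commute add.commute)
  qed
  then show ?thesis using norm_band_damp_bounds(2)[of z \<alpha> \<beta>] by (simp add: p_def q_def)
qed

lemma band_root_right:
  assumes "\<alpha> < \<beta>" "\<beta> < x"
  shows "band_root \<alpha> \<beta> (of_real x) = of_real (sqrt (\<bar>x - \<alpha>\<bar> * \<bar>x - \<beta>\<bar>))"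
proof -
  have "band_ratio \<alpha> \<beta> (of_real x) = csqrt (of_real ((x - \<beta>) / (x - \<alpha>)))"
    by (simp add: band_ratio_def)
  also have "\<dots> = of_real (sqrt ((x - \<beta>) / (x - \<alpha>)))"
    using assms by (intro of_real_sqrt[symmetric]) auto
  finally have "band_root \<alpha> \<beta> (of_real x) = of_real ((x - \<alpha>) * sqrt ((x - \<beta>) / (x - \<alpha>)))"
    by (simp add: band_root_def)
  also have "(x - \<alpha>) * sqrt ((x - \<beta>) / (x - \<alpha>)) = sqrt (\<bar>x - \<alpha>\<bar> * \<bar>x - \<beta>\<bar>)"
    using assms by (simp add: mult_sqrt_divide abs_if mult_ac)
  finally show ?thesis .
qed

text \<open>The ratio is positive on this side and the factor \<open>z - \<alpha>\<close> is
  negative. This sign is the one that \<open>node_sign\<close> collects.\<close>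

lemma band_root_left:
  assumes "\<alpha> < \<beta>" "x < \<alpha>"
  shows "band_root \<alpha> \<beta> (of_real x) = - of_real (sqrt (\<bar>x - \<alpha>\<bar> * \<bar>x - \<beta>\<bar>))"
proof -
  have "band_ratio \<alpha> \<beta> (of_real x) = csqrt (of_real ((\<beta> - x) / (\<alpha> - x)))"
    using assms by (simp add: band_ratio_def divide_simps) (simp add: algebra_simps)
  also have "\<dots> = of_real (sqrt ((\<beta> - x) / (\<alpha> - x)))"
    using assms by (intro of_real_sqrt[symmetric]) auto
  finally have "band_root \<alpha> \<beta> (of_real x) = - of_real ((\<alpha> - x) * sqrt ((\<beta> - x) / (\<alpha> - x)))"
    by (simp add: band_root_def algebra_simps)
  also have "(\<alpha> - x) * sqrt ((\<beta> - x) / (\<alpha> - x)) = sqrt (\<bar>x - \<alpha>\<bar> * \<bar>x - \<beta>\<bar>)"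
    using assms by (simp add: mult_sqrt_divide abs_if mult_ac)
  finally show ?thesis .
qed

lemma band_root_limits:
  assumes "\<alpha> < x" "x < \<beta>"
  shows "(band_root \<alpha> \<beta> \<longlongrightarrow> \<i> * of_real (sqrt (\<bar>x - \<alpha>\<bar> * \<bar>x - \<beta>\<bar>))) (up x)"
    and "(band_root \<alpha> \<beta> \<longlongrightarrow> - (\<i> * of_real (sqrt (\<bar>x - \<alpha>\<bar> * \<bar>x - \<beta>\<bar>)))) (dn x)"
proof -
  \<comment> \<open>The radicand is positive on the band, so \<open>g\<close> is continuous across
    it. The two sides of the band differ only through \<open>csqrt (- w)\<close>, which is
    \<open>\<i> * csqrt w\<close> or its negative according to the half-plane of
    \<open>w\<close>.\<close>
  define g where "g z = (z - of_real \<alpha>) * (\<i> * csqrt ((of_real \<beta> - z) / (z - of_real \<alpha>)))" for z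
  have ratio: "(of_real \<beta> - of_real x) / (of_real x - of_real \<alpha>) = complex_of_real ((\<beta> - x) / (x - \<alpha>))"
    by simp
  have "(of_real \<beta> - of_real x) / (of_real x - of_real \<alpha>) \<notin> (\<real>\<^sub>\<le>\<^sub>0 :: complex set)"
    unfolding ratio nonpos_Reals_of_real_iff using assms by (simp add: not_le)
  then have cont: "isCont g (of_real x)"
    unfolding g_def using assms by (intro continuous_intros isCont_csqrt') auto
  have val: "g (of_real x) = \<i> * of_real (sqrt (\<bar>x - \<alpha>\<bar> * \<bar>x - \<beta>\<bar>))"
  proof -
    have "g (of_real x) = \<i> * of_real ((x - \<alpha>) * sqrt ((\<beta> - x) / (x - \<alpha>)))"
      unfolding g_def ratio using assms by (subst of_real_sqrt[symmetric]) auto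
    also have "(x - \<alpha>) * sqrt ((\<beta> - x) / (x - \<alpha>)) = sqrt (\<bar>x - \<alpha>\<bar> * \<bar>x - \<beta>\<bar>)"
      using assms by (simp add: mult_sqrt_divide abs_if mult_ac)
    finally show ?thesis .
  qed
  have Im: "Im ((of_real \<beta> - z) / (z - of_real \<alpha>)) = - Im z * (\<beta> - \<alpha>) / norm (z - of_real \<alpha>) ^ 2"
    for z
    by (simp add: Im_divide cmod_power2 algebra_simps)
  have neg: "(z - of_real \<beta>) / (z - of_real \<alpha>) = - ((of_real \<beta> - z) / (z - of_real \<alpha>))" for z :: complex
    by (metis minus_diff_eq minus_divide_left)
  have nz: "norm (z - complex_of_real \<alpha>) > 0" if "Im z \<noteq> 0" for z using that by auto
  have up_eq: "band_root \<alpha> \<beta> z = g z" if "Im z > 0" for z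
  proof -
    have "Im ((of_real \<beta> - z) / (z - of_real \<alpha>)) < 0"
      unfolding Im using nz[of z] that assms by (intro divide_neg_pos mult_neg_pos) auto
    then show ?thesis
      unfolding band_root_def band_ratio_def g_def neg by (subst csqrt_minus) auto
  qed
  have dn_eq: "band_root \<alpha> \<beta> z = - g z" if "Im z < 0" for z
  proof -
    have "Im ((of_real \<beta> - z) / (z - of_real \<alpha>)) > 0"
      unfolding Im using nz[of z] that assms by (intro divide_pos_pos mult_pos_pos) auto
    then have "Im ((z - of_real \<beta>) / (z - of_real \<alpha>)) < 0" by (simp only: neg) simp
    then have "csqrt (- ((z - of_real \<beta>) / (z - of_real \<alpha>))) = \<i> * csqrt ((z - of_real \<beta>) / (z - of_real \<alpha>))"
      by (intro csqrt_minus) auto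
    then have "csqrt ((of_real \<beta> - z) / (z - of_real \<alpha>)) = \<i> * band_ratio \<alpha> \<beta> z"
      by (simp add: neg band_ratio_def)
    then show ?thesis by (simp add: band_root_def g_def)
  qed
  have g_lim: "(g \<longlongrightarrow> g (of_real x)) (at (of_real x) within S)" for S
    using cont unfolding isCont_def by (rule tendsto_within_subset) simp
  show "(band_root \<alpha> \<beta> \<longlongrightarrow> \<i> * of_real (sqrt (\<bar>x - \<alpha>\<bar> * \<bar>x - \<beta>\<bar>))) (up x)"
    using g_lim unfolding val
    by (rule Lim_transform_eventually) (use eventually_up_Im in eventually_elim, simp add: up_eq)
  show "(band_root \<alpha> \<beta> \<longlongrightarrow> - (\<i> * of_real (sqrt (\<bar>x - \<alpha>\<bar> * \<bar>x - \<beta>\<bar>)))) (dn x)"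
    using tendsto_minus[OF g_lim] unfolding val
    by (rule Lim_transform_eventually) (use eventually_dn_Im in eventually_elim, simp add: dn_eq)
qed

subsection \<open>Lagrange interpolation\<close>

lemma Lagrange_interpolation:
  fixes p :: "'a::field poly"
  assumes "finite I" "inj_on c I" "degree p < card I"
  shows "p = (\<Sum>k\<in>I. smult (poly p (c k) / (\<Prod>j\<in>I-{k}. c k - c j)) (\<Prod>j\<in>I-{k}. [:- c j, 1:]))"
    (is "p = ?q")
proof (rule poly_eqI_degree)
  have deg: "degree (\<Prod>j\<in>I-{k}. [:- c j, 1:]) \<le> card I - 1" if "k \<in> I" for k
    using degree_prod_sum_le[of "I - {k}" "\<lambda>j. [:- c j, 1:]"] assms(1) that by simp
  have "degree ?q \<le> card I - 1"
    by (intro degree_sum_le) (use assms(1) deg degree_smult_le in \<open>auto intro: order.trans\<close>)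
  then show "degree ?q < card (c ` I)"
    using assms by (simp add: card_image)
  show "degree p < card (c ` I)" using assms by (simp add: card_image)
  fix x assume "x \<in> c ` I"
  then obtain i where i: "i \<in> I" "x = c i" by blast
  have "poly ?q x = (\<Sum>k\<in>I. if k = i then poly p (c i) else 0)"
    unfolding poly_sum
  proof (rule sum.cong[OF refl])
    fix k assume k: "k \<in> I"
    show "poly (smult (poly p (c k) / (\<Prod>j\<in>I-{k}. c k - c j)) (\<Prod>j\<in>I-{k}. [:- c j, 1:])) x =
        (if k = i then poly p (c i) else 0)"
    proof (cases "k = i")
      case True
      have "(\<Prod>j\<in>I-{i}. c i - c j) \<noteq> 0"
        using assms i by (auto simp: prod_zero_iff inj_on_def)
      then show ?thesis using True i by (simp add: poly_prod)
    next
      case False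
      have "(\<Prod>j\<in>I-{k}. poly [:- c j, 1:] x) = 0"
        by (rule prod_zero) (use False assms i in auto)
      then show ?thesis using False by (simp add: poly_prod)
    qed
  qed
  also have "\<dots> = poly p x" using assms(1) i by simp
  finally show "poly p x = poly ?q x" by simp
qed

text \<open>Each basis product is monic of degree \<open>card I - 1\<close>, so this coefficient,
  possibly zero, is the divided difference of \<open>p\<close> at the nodes.\<close>

lemma coeff_Lagrange_interpolation:
  fixes p :: "'a::field poly"
  assumes "finite I" "inj_on c I" "degree p < card I"
  shows "coeff p (card I - 1) = (\<Sum>k\<in>I. poly p (c k) / (\<Prod>j\<in>I-{k}. c k - c j))"
proof -
  have "coeff (\<Prod>j\<in>I-{k}. [:- c j, 1:]) (card I - 1) = 1" if "k \<in> I" for k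
  proof -
    have "degree (\<Prod>j\<in>I-{k}. [:- c j, 1:]) = card I - 1"
      using that assms(1) by (subst degree_prod_eq_sum_degree) auto
    then show ?thesis
      using lead_coeff_prod[of "\<lambda>j. [:- c j, 1:]" "I - {k}"] by simp
  qed
  then show ?thesis
    by (subst Lagrange_interpolation[OF assms]) (simp add: coeff_sum)
qed

subsection \<open>The configuration of bands\<close>

locale band_config =
  fixes N :: nat and a b :: "nat \<Rightarrow> real"
  assumes N_ge_1: "N \<ge> 1"
    and a_less_b: "k \<in> {1..N} \<Longrightarrow> a k < b k"
    and b_less_a_Suc: "k \<in> {1..<N} \<Longrightarrow> b k < a (Suc k)"
begin

abbreviation cut :: "complex set" where "cut \<equiv> rhp_cut N a b"

definition endpoints :: "complex set" where
  "endpoints = complex_of_real ` (a ` {1..N} \<union> b ` {1..N})"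

text \<open>The gaps belong to this set: \<open>bands_root\<close> is holomorphic across them and
  the moduli of the row entries have equal limits from both sides. It is the domain for the maximum
  principle.\<close>

definition off_bands :: "complex set" where
  "off_bands = - (\<Union>k\<in>{1..N}. complex_of_real ` {a k..b k})"

definition bands_root :: "complex \<Rightarrow> complex" where
  "bands_root z = (\<Prod>k\<in>{1..N}. band_root (a k) (b k) z)"

section \<open>Order of the endpoints and topology of the cut\<close>

lemma b_less_a: "1 \<le> j \<Longrightarrow> j < k \<Longrightarrow> k \<le> N \<Longrightarrow> b j < a k"
proof (induction k)
  case (Suc k)
  then show ?case
    using a_less_b[of k] b_less_a_Suc[of k] by (cases "j = k") force+
qed simp

lemma a_1_le: "k \<in> {1..N} \<Longrightarrow> a 1 \<le> a k"
  using b_less_a[of 1 k] a_less_b[of 1] N_ge_1 by (cases "k = 1") force+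

lemma b_le_b_N: "k \<in> {1..N} \<Longrightarrow> b k \<le> b N"
  using b_less_a[of k N] a_less_b[of N] N_ge_1 by (cases "k = N") force+

lemma a_1_less_b_N: "a 1 < b N"
  using a_1_le[of N] a_less_b[of N] N_ge_1 by force

lemma of_real_in_cut_iff: "complex_of_real x \<in> cut \<longleftrightarrow> a 1 \<le> x \<and> x \<le> b N"
  by (auto simp: rhp_cut_def)

lemma nonreal_notin_cut: "Im z \<noteq> 0 \<Longrightarrow> z \<notin> cut"
  by (auto simp: rhp_cut_def)

lemma closed_segment_image: "closed (complex_of_real ` {x..y})"
  by (intro compact_imp_closed compact_continuous_image continuous_intros compact_Icc)

lemma open_cut_compl: "open (- cut)"
  unfolding rhp_cut_def using closed_segment_image by (simp add: open_Compl)

lemma open_off_bands: "open off_bands"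
  unfolding off_bands_def using closed_segment_image by (intro open_Compl closed_UN) auto

lemma cut_compl_subset_off_bands: "- cut \<subseteq> off_bands"
  unfolding off_bands_def rhp_cut_def using a_1_le b_le_b_N by fastforce

lemma finite_endpoints: "finite endpoints"
  by (simp add: endpoints_def)

lemma endpoints_subset_cut: "endpoints \<subseteq> cut"
proof -
  have "a 1 \<le> a k \<and> a k \<le> b N" "a 1 \<le> b k \<and> b k \<le> b N" if "k \<in> {1..N}" for k
    using a_1_le[OF that] b_le_b_N[OF that] a_less_b[OF that] by auto
  then show ?thesis by (auto simp: endpoints_def of_real_in_cut_iff)
qed

lemma cnj_in_cut_iff: "cnj z \<in> cut \<longleftrightarrow> z \<in> cut"
  by (auto simp: rhp_cut_def image_iff complex_eq_iff)

lemma cut_cases: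
  assumes "a 1 \<le> x" "x \<le> b N"
  obtains (end_a) k where "k \<in> {1..N}" "x = a k"
    | (end_b) k where "k \<in> {1..N}" "x = b k"
    | (band) k where "k \<in> {1..N}" "a k < x" "x < b k"
    | (gap) k where "k \<in> {1..<N}" "b k < x" "x < a (Suc k)"
proof -
  define K where "K = {k\<in>{1..N}. a k \<le> x}"
  define k where "k = Max K"
  have "finite K" "1 \<in> K" using assms N_ge_1 by (auto simp: K_def)
  then have k: "k \<in> K" unfolding k_def by (intro Max_in) auto
  have kN: "k \<in> {1..N}" "a k \<le> x" using k by (auto simp: K_def)
  have Suc: "x < a (Suc k)" if "k < N"
  proof (rule ccontr)
    assume "\<not> x < a (Suc k)"
    then have "Suc k \<in> K" using that k by (auto simp: K_def)
    then show False using Max_ge[OF \<open>finite K\<close>, of "Suc k"] by (simp add: k_def)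
  qed
  consider "x = a k" | "x = b k" | "a k < x" "x < b k" | "b k < x" using kN by linarith
  then show thesis
  proof cases
    case 4
    then have "k \<in> {1..<N}" using kN assms(2) by (cases "k = N") auto
    then show thesis using 4 Suc end_a end_b band gap by simp
  qed (use kN end_a end_b band in blast)+
qed

lemma off_bands_in_cut:
  assumes "z \<in> off_bands" "z \<in> cut"
  obtains x k where "z = of_real x" "k \<in> {1..<N}" "b k < x" "x < a (Suc k)"
proof -
  obtain x where x: "z = of_real x" "a 1 \<le> x" "x \<le> b N" using assms(2) by (auto simp: rhp_cut_def)
  from x(2,3) show ?thesis
  proof (cases rule: cut_cases)
    case (gap k)
    then show ?thesis using that x by blast
  next
    case (end_a k)
    then show ?thesis using assms(1) x a_less_b[of k] by (force simp: off_bands_def)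
  next
    case (end_b k)
    then have "x \<in> {a k..b k}" using a_less_b[of k] by auto
    then show ?thesis using assms(1) end_b(1) unfolding off_bands_def x(1) by blast
  next
    case (band k)
    then have "x \<in> {a k..b k}" by auto
    then show ?thesis using assms(1) band(1) unfolding off_bands_def x(1) by blast
  qed
qed

lemma gap_in_off_bands:
  assumes "k \<in> {1..<N}" "b k < x" "x < a (Suc k)"
  shows "complex_of_real x \<in> off_bands"
proof -
  have "x \<notin> {a j..b j}" if j: "j \<in> {1..N}" for j
  proof (cases "j \<le> k")
    case True
    then have "b j \<le> b k" using b_less_a[of j k] a_less_b[of k] j assms by (cases "j = k") force+
    then show ?thesis using assms by auto
  next
    case False
    then have "a (Suc k) \<le> a j"
      using b_less_a[of "Suc k" j] a_less_b[of "Suc k"] j assms by (cases "j = Suc k") force+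
    then show ?thesis using assms by auto
  qed
  then show ?thesis by (auto simp: off_bands_def)
qed

text \<open>Applied to \<open>sesqui f g * bands_root\<close> and to the determinant. Equal
  one-sided limits remove the line apart from the endpoints; there a bound of order |z - c|^(-1/2)
  forces (z - c) h to 0, so the endpoints are removable as well.\<close>

lemma entire_extension:
  assumes hol: "g holomorphic_on - cut"
    and band: "\<And>k x. k \<in> {1..N} \<Longrightarrow> a k < x \<Longrightarrow> x < b k \<Longrightarrow>
                 \<exists>L. (g \<longlongrightarrow> L) (up x) \<and> (g \<longlongrightarrow> L) (dn x)"
    and gap: "\<And>k x. k \<in> {1..<N} \<Longrightarrow> b k < x \<Longrightarrow> x < a (Suc k) \<Longrightarrow>
                 \<exists>L. (g \<longlongrightarrow> L) (up x) \<and> (g \<longlongrightarrow> L) (dn x)"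
    and ends: "\<And>c. c \<in> endpoints \<Longrightarrow>
                 \<exists>B. eventually (\<lambda>z. norm (g z) * sqrt (norm (z - c)) \<le> B) (at c within - cut)"
  obtains h where "h holomorphic_on UNIV" "\<And>z. z \<notin> cut \<Longrightarrow> h z = g z"
proof -
  have S: "open (- endpoints)"
    using finite_endpoints by (simp add: finite_imp_closed open_Compl)
  have g_cont: "isCont g z" if "z \<notin> cut" for z
    using hol open_cut_compl that
    by (metis ComplI continuous_on_eq_continuous_at holomorphic_on_imp_continuous_on)
  have lim: "\<exists>L. (g \<longlongrightarrow> L) (up x) \<and> (g \<longlongrightarrow> L) (dn x)"
    if x: "complex_of_real x \<in> - endpoints" for x
  proof (cases "complex_of_real x \<in> cut")
    case False
    then show ?thesis
      using g_cont[OF False] up_le_at dn_le_at unfolding isCont_def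
      by (blast intro: tendsto_mono)
  next
    case True
    then have "a 1 \<le> x" "x \<le> b N" by (auto simp: of_real_in_cut_iff)
    then show ?thesis
      by (cases rule: cut_cases) (use x band gap in \<open>auto simp: endpoints_def\<close>)
  qed
  have "g holomorphic_on (- endpoints - \<real>)"
    by (rule holomorphic_on_subset[OF hol]) (use nonreal_notin_cut in \<open>auto simp: complex_is_Real_iff\<close>)
  then obtain h where h: "h holomorphic_on - endpoints"
      "\<And>z. z \<in> - endpoints \<Longrightarrow> Im z \<noteq> 0 \<Longrightarrow> h z = g z"
    using holomorphic_glue_real_line[OF S _ lim] by metis
  have h_cont: "isCont h z" if "z \<notin> endpoints" for z
    using h(1) S that
    by (metis ComplI continuous_on_eq_continuous_at holomorphic_on_imp_continuous_on)
  have nonreal: "Im z \<noteq> 0 \<Longrightarrow> h z = g z" for z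
    using h(2)[of z] nonreal_notin_cut[of z] endpoints_subset_cut by auto
  have hg: "h z = g z" if z: "z \<notin> cut" for z
  proof (cases "Im z = 0")
    case True
    then obtain x where x: "z = of_real x" using complex_is_Real_iff Reals_cases by metis
    have "(g \<longlongrightarrow> g z) (up x)"
      using g_cont[OF z] up_le_at unfolding isCont_def x by (rule tendsto_mono[rotated])
    moreover have "(h \<longlongrightarrow> h z) (up x)"
      using h_cont[of z] up_le_at endpoints_subset_cut z unfolding isCont_def x
      by (blast intro: tendsto_mono)
    then have "(g \<longlongrightarrow> h z) (up x)"
      by (rule Lim_transform_eventually)
        (use eventually_up_Im[of x] in eventually_elim, simp add: nonreal)
    ultimately show ?thesis using tendsto_unique[OF up_neq_bot] by blast
  qed (use nonreal in simp)
  have sing: "((\<lambda>z. (z - c) * h z) \<longlongrightarrow> 0) (at c)" if c: "c \<in> endpoints" for c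
  proof -
    obtain B where "eventually (\<lambda>z. norm (g z) * sqrt (norm (z - c)) \<le> B) (at c within - cut)"
      using ends[OF c] by blast
    then obtain d where d: "d > 0" "\<And>z. z \<notin> cut \<Longrightarrow> z \<noteq> c \<Longrightarrow> dist z c < d \<Longrightarrow>
        norm (g z) * sqrt (norm (z - c)) \<le> B"
      unfolding eventually_at by blast
    \<comment> \<open>The hypothesis at \<open>c\<close> concerns only points off the cut; at points
      of the cut the bound is inherited from the upper half-plane by continuity of
      \<open>h\<close>.\<close>
    have hb: "norm (h z) * sqrt (norm (z - c)) \<le> B" if z: "z \<notin> endpoints" "z \<in> ball c d" for z
    proof (cases "Im z = 0")
      case False
      then show ?thesis
        using d(2)[of z] nonreal nonreal_notin_cut z c by (auto simp: dist_commute)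
    next
      case True
      then obtain x where x: "z = of_real x" using complex_is_Real_iff Reals_cases by metis
      have hup: "(h \<longlongrightarrow> h z) (up x)"
        using h_cont[OF z(1)] up_le_at unfolding isCont_def x by (blast intro: tendsto_mono)
      have "((\<lambda>w. norm (h w) * sqrt (norm (w - c))) \<longlongrightarrow> norm (h z) * sqrt (norm (z - c))) (up x)"
        unfolding x by (intro tendsto_intros hup[unfolded x])
      moreover have "eventually (\<lambda>w. w \<in> ball c d) (up x)"
        using z(2) unfolding x by (intro eventually_at_in_open'[THEN filter_leD[OF up_le_at]]) auto
      then have "eventually (\<lambda>w. norm (h w) * sqrt (norm (w - c)) \<le> B) (up x)"
        using eventually_up_Im[of x]
      proof eventually_elim
        case (elim w)
        then show ?case
          using d(2)[of w] nonreal[of w] nonreal_notin_cut[of w] c endpoints_subset_cut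
          by (auto simp: dist_commute)
      qed
      ultimately show ?thesis by (intro tendsto_upperbound) auto
    qed
    have "eventually (\<lambda>z. z \<in> - (endpoints - {c}) \<inter> ball c d - {c}) (at c)"
      using finite_endpoints d(1) by (intro eventually_at_in_open open_Int open_Compl finite_imp_closed) auto
    then have ev: "eventually (\<lambda>z. norm ((z - c) * h z) \<le> B * sqrt (norm (z - c))) (at c)"
    proof eventually_elim
      case (elim z)
      then have "norm (h z) * sqrt (norm (z - c)) \<le> B" by (intro hb) auto
      then have "norm (h z) * sqrt (norm (z - c)) * sqrt (norm (z - c)) \<le> B * sqrt (norm (z - c))"
        by (rule mult_right_mono) simp
      moreover have "sqrt (norm (z - c)) * sqrt (norm (z - c)) = norm (z - c)" by simp
      ultimately show ?case by (metis norm_mult mult.assoc mult.commute)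
    qed
    have "((\<lambda>z. B * sqrt (norm (z - c))) \<longlongrightarrow> B * sqrt (norm (c - c))) (at c)"
      by (intro tendsto_intros)
    then have "((\<lambda>z. B * sqrt (norm (z - c))) \<longlongrightarrow> 0) (at c)" by simp
    then show ?thesis by (rule Lim_null_comparison[OF ev])
  qed
  obtain k where k: "k holomorphic_on UNIV" "\<And>z. z \<notin> endpoints \<Longrightarrow> k z = h z"
    using holomorphic_remove_finite_singularities[OF finite_endpoints h(1) sing] by blast
  have "k z = g z" if "z \<notin> cut" for z
    using k(2)[of z] hg[OF that] endpoints_subset_cut that by auto
  then show thesis by (rule that[OF k(1)])
qed

section \<open>The square root attached to all bands\<close>

lemma bands_root_holomorphic: "bands_root holomorphic_on off_bands"
  unfolding bands_root_def
  by (intro holomorphic_on_prod holomorphic_on_subset[OF band_root_holomorphic] a_less_b)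
    (auto simp: off_bands_def)

lemma norm_bands_root: "norm (bands_root z) = (\<Prod>k\<in>{1..N}. sqrt (norm (z - of_real (a k)) * norm (z - of_real (b k))))"
  by (simp add: bands_root_def prod_norm[symmetric] norm_band_root)

lemma isCont_norm_bands_root: "isCont (\<lambda>z. norm (bands_root z)) z"
  unfolding norm_bands_root by (intro continuous_intros)

lemma bands_root_endpoint: "c \<in> endpoints \<Longrightarrow> bands_root c = 0"
proof -
  assume "c \<in> endpoints"
  then obtain k where k: "k \<in> {1..N}" "c = of_real (a k) \<or> c = of_real (b k)"
    by (auto simp: endpoints_def)
  then have "band_root (a k) (b k) c = 0" by (auto simp: band_root_def band_ratio_def)
  then show ?thesis unfolding bands_root_def using k(1) by (intro prod_zero) auto
qed

text \<open>Equal to (-1)^(N - k) for \<open>k\<close> in \<open>{1..N}\<close>. The product over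
  the other bands matches, factor by factor, both the remaining factors of \<open>bands_root\<close>
  on band \<open>k\<close> and the Lagrange denominators for one node in each band.\<close>

definition node_sign :: "nat \<Rightarrow> real" where
  "node_sign k = (\<Prod>j\<in>{1..N}-{k}. if j < k then 1 else -1)"

lemma norm_node_sign: "\<bar>node_sign k\<bar> = 1"
  unfolding node_sign_def abs_prod by (rule prod.neutral) auto

text \<open>On band \<open>k\<close> its own factor is imaginary and changes sign between the two
  sides. Every other factor is continuous and real there, positive for bands to the left and
  negative for bands to the right.\<close>

lemma bands_root_limits:
  assumes k: "k \<in> {1..N}" and x: "a k < x" "x < b k"
  shows "(bands_root \<longlongrightarrow> \<i> * of_real (node_sign k * norm (bands_root (of_real x)))) (up x)"
    and "(bands_root \<longlongrightarrow> - (\<i> * of_real (node_sign k * norm (bands_root (of_real x))))) (dn x)"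
proof -
  define s where "s j = sqrt (\<bar>x - a j\<bar> * \<bar>x - b j\<bar>)" for j
  have nr: "norm (bands_root (of_real x)) = (\<Prod>j\<in>{1..N}. s j)"
    unfolding norm_bands_root s_def by (simp only: of_real_diff[symmetric] norm_of_real)
  have oth: "(band_root (a j) (b j) \<longlongrightarrow> (if j < k then of_real (s j) else - of_real (s j)))
      (at (of_real x) within T)" if j: "j \<in> {1..N} - {k}" for j T
  proof -
    have ab: "a j < b j" using a_less_b j by auto
    have out: "x < a j \<and> \<not> j < k \<or> b j < x \<and> j < k"
      using b_less_a[of j k] b_less_a[of k j] j k x by (cases "j < k") force+
    then have xin: "complex_of_real x \<in> - complex_of_real ` {a j..b j}" using ab by auto
    have "isCont (band_root (a j) (b j)) (of_real x)"
      using holomorphic_on_imp_continuous_on[OF band_root_holomorphic[OF ab]] xin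
        continuous_on_eq_continuous_at[OF open_Compl[OF closed_segment_image]] by blast
    moreover have "band_root (a j) (b j) (of_real x) = (if j < k then of_real (s j) else - of_real (s j))"
      using out ab band_root_left band_root_right unfolding s_def by auto
    ultimately have "(band_root (a j) (b j) \<longlongrightarrow> (if j < k then of_real (s j) else - of_real (s j))) (at (of_real x))"
      unfolding isCont_def by simp
    then show ?thesis by (rule tendsto_within_subset) simp
  qed
  have split: "(\<Prod>j\<in>{1..N}. u j) = u k * (\<Prod>j\<in>{1..N}-{k}. u j)" for u :: "nat \<Rightarrow> complex"
    using k by (simp add: prod.remove)
  have split': "(\<Prod>j\<in>{1..N}. u j) = u k * (\<Prod>j\<in>{1..N}-{k}. u j)" for u :: "nat \<Rightarrow> real"
    using k by (simp add: prod.remove)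
  have rest: "(\<Prod>j\<in>{1..N}-{k}. if j < k then of_real (s j) else - of_real (s j)) =
      complex_of_real (node_sign k * (\<Prod>j\<in>{1..N}-{k}. s j))"
    unfolding node_sign_def prod.distrib[symmetric] of_real_prod by (rule prod.cong) auto
  have "((\<lambda>z. band_root (a k) (b k) z * (\<Prod>j\<in>{1..N}-{k}. band_root (a j) (b j) z)) \<longlongrightarrow>
      \<i> * of_real (s k) * (\<Prod>j\<in>{1..N}-{k}. if j < k then of_real (s j) else - of_real (s j))) (up x)"
    unfolding s_def by (intro tendsto_mult tendsto_prod band_root_limits x oth[unfolded s_def])
  then show "(bands_root \<longlongrightarrow> \<i> * of_real (node_sign k * norm (bands_root (of_real x)))) (up x)"
    unfolding nr split' rest unfolding bands_root_def[abs_def] split by (simp add: mult_ac)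
  have "((\<lambda>z. band_root (a k) (b k) z * (\<Prod>j\<in>{1..N}-{k}. band_root (a j) (b j) z)) \<longlongrightarrow>
      - (\<i> * of_real (s k)) * (\<Prod>j\<in>{1..N}-{k}. if j < k then of_real (s j) else - of_real (s j))) (dn x)"
    unfolding s_def by (intro tendsto_mult tendsto_prod band_root_limits x oth[unfolded s_def])
  then show "(bands_root \<longlongrightarrow> - (\<i> * of_real (node_sign k * norm (bands_root (of_real x))))) (dn x)"
    unfolding nr split' rest unfolding bands_root_def[abs_def] split by (simp add: mult_ac)
qed

text \<open>A common form for both rows of a solution. The phases appear only as existentially
  quantified unimodular numbers, so a constant valid for all row solutions cannot depend on them.
  One \<open>u\<close> serves a whole gap, which allows local holomorphic continuation across it
  after a rotation by \<open>cnj u\<close>.\<close>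

definition row_solution :: "(complex \<Rightarrow> complex) \<Rightarrow> (complex \<Rightarrow> complex) \<Rightarrow> bool" where
  "row_solution f g \<longleftrightarrow>
     f holomorphic_on - cut \<and> g holomorphic_on - cut \<and>
     (\<forall>k\<in>{1..N}. \<forall>x\<in>{a k<..<b k}. \<exists>p q.
        (f \<longlongrightarrow> p) (up x) \<and> (g \<longlongrightarrow> q) (up x) \<and> (f \<longlongrightarrow> q) (dn x) \<and> (g \<longlongrightarrow> - p) (dn x)) \<and>
     (\<forall>k\<in>{1..<N}. \<exists>u. norm u = 1 \<and> (\<forall>x\<in>{b k<..<a (Suc k)}. \<exists>p q.
        (f \<longlongrightarrow> p) (up x) \<and> (g \<longlongrightarrow> q) (up x) \<and> (f \<longlongrightarrow> u * p) (dn x) \<and> (g \<longlongrightarrow> cnj u * q) (dn x))) \<and>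
     (f \<longlongrightarrow> 1) at_infinity \<and>
     (\<exists>B. eventually (\<lambda>z. norm (g z) * norm z \<le> B) at_infinity) \<and>
     (\<forall>c\<in>endpoints. \<exists>B. eventually (\<lambda>z. norm (f z) * norm (z - c) powr (1/4) \<le> B \<and>
        norm (g z) * norm (z - c) powr (1/4) \<le> B) (at c within - cut))"

lemma row_solution_holomorphic:
  assumes "row_solution f g"
  shows "f holomorphic_on - cut" "g holomorphic_on - cut"
  using assms by (simp_all add: row_solution_def)

lemma row_solution_band:
  assumes "row_solution f g" "k \<in> {1..N}" "a k < x" "x < b k"
  obtains p q where "(f \<longlongrightarrow> p) (up x)" "(g \<longlongrightarrow> q) (up x)" "(f \<longlongrightarrow> q) (dn x)" "(g \<longlongrightarrow> - p) (dn x)"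
proof -
  have "\<forall>k\<in>{1..N}. \<forall>x\<in>{a k<..<b k}. \<exists>p q.
        (f \<longlongrightarrow> p) (up x) \<and> (g \<longlongrightarrow> q) (up x) \<and> (f \<longlongrightarrow> q) (dn x) \<and> (g \<longlongrightarrow> - p) (dn x)"
    using assms(1) unfolding row_solution_def by (elim conjE)
  from bspec[OF bspec[OF this assms(2)], of x] assms(3,4) that show thesis by auto
qed

lemma row_solution_gap:
  assumes "row_solution f g" "k \<in> {1..<N}"
  obtains u where "norm u = 1"
    and "\<And>x. b k < x \<Longrightarrow> x < a (Suc k) \<Longrightarrow> \<exists>p q. (f \<longlongrightarrow> p) (up x) \<and> (g \<longlongrightarrow> q) (up x) \<and>
           (f \<longlongrightarrow> u * p) (dn x) \<and> (g \<longlongrightarrow> cnj u * q) (dn x)"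
proof -
  have "\<forall>k\<in>{1..<N}. \<exists>u. norm u = 1 \<and> (\<forall>x\<in>{b k<..<a (Suc k)}. \<exists>p q.
        (f \<longlongrightarrow> p) (up x) \<and> (g \<longlongrightarrow> q) (up x) \<and> (f \<longlongrightarrow> u * p) (dn x) \<and> (g \<longlongrightarrow> cnj u * q) (dn x))"
    using assms(1) unfolding row_solution_def by (elim conjE)
  from bspec[OF this assms(2)] obtain u where u: "norm u = 1"
    "\<forall>x\<in>{b k<..<a (Suc k)}. \<exists>p q. (f \<longlongrightarrow> p) (up x) \<and> (g \<longlongrightarrow> q) (up x) \<and>
       (f \<longlongrightarrow> u * p) (dn x) \<and> (g \<longlongrightarrow> cnj u * q) (dn x)" by (elim exE conjE)
  show thesis
    by (rule that[OF u(1)], rule bspec[OF u(2)], simp)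
qed

lemma row_solution_infinity:
  assumes "row_solution f g"
  shows "(f \<longlongrightarrow> 1) at_infinity" "\<exists>B. eventually (\<lambda>z. norm (g z) * norm z \<le> B) at_infinity"
  using assms by (simp_all add: row_solution_def)

lemma row_solution_endpoint:
  assumes "row_solution f g" "c \<in> endpoints"
  shows "\<exists>B. eventually (\<lambda>z. norm (f z) * norm (z - c) powr (1/4) \<le> B \<and>
     norm (g z) * norm (z - c) powr (1/4) \<le> B) (at c within - cut)"
  using assms unfolding row_solution_def by (elim conjE bspec)

text \<open>The \<open>S\<close> of the overview, that is the determinant formed by the row and its
  Schwarz reflection.\<close>

definition sesqui :: "(complex \<Rightarrow> complex) \<Rightarrow> (complex \<Rightarrow> complex) \<Rightarrow> complex \<Rightarrow> complex" where
  "sesqui f g z = f z * cnj (g (cnj z)) - g z * cnj (f (cnj z))"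

lemma sesqui_holomorphic:
  assumes "f holomorphic_on - cut" "g holomorphic_on - cut"
  shows "sesqui f g holomorphic_on - cut"
proof -
  have im: "cnj ` (- cut) = - cut"
    using cnj_in_cut_iff by (metis (no_types, opaque_lifting) ComplD ComplI complex_cnj_cnj image_eqI image_subsetI subsetI subset_antisym)
  have "cnj \<circ> f \<circ> cnj holomorphic_on - cut" "cnj \<circ> g \<circ> cnj holomorphic_on - cut"
    using assms open_cut_compl by (auto intro!: holomorphic_on_compose_cnj_cnj simp: im)
  then show ?thesis
    unfolding sesqui_def[abs_def] using assms by (auto intro!: holomorphic_intros simp: o_def)
qed

lemma powr_quarter_square: "(r::real) \<ge> 0 \<Longrightarrow> r powr (1/4) * r powr (1/4) = sqrt r"
  by (simp add: powr_add[symmetric] powr_half_sqrt)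

text \<open>Two fourth-root singularities multiply to a square-root singularity, the growth that
  \<open>entire_extension\<close> tolerates.\<close>

lemma quarter_root_product:
  assumes "norm u * r powr (1/4) \<le> B" "norm v * r powr (1/4) \<le> B" "r \<ge> 0"
  shows "norm (u * v :: complex) * sqrt r \<le> B * B"
proof -
  have "norm (u * v) * sqrt r = (norm u * r powr (1/4)) * (norm v * r powr (1/4))"
    using powr_quarter_square[OF assms(3)] by (simp add: norm_mult mult_ac)
  also have "\<dots> \<le> B * B"
    using assms by (intro mult_mono) (auto intro: order.trans[OF _ assms(1)])
  finally show ?thesis .
qed

subsection \<open>The polynomial attached to a row\<close>

text \<open>Reflection interchanges the half-planes, so each one-sided limit of
  \<open>sesqui\<close> pairs limits of \<open>f\<close> and \<open>g\<close> from that side with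
  conjugated limits from the other side.\<close>

lemma sesqui_reflect_limits:
  assumes "(f \<longlongrightarrow> p) (up x)" "(g \<longlongrightarrow> q) (up x)" "(f \<longlongrightarrow> p') (dn x)" "(g \<longlongrightarrow> q') (dn x)"
  shows "(sesqui f g \<longlongrightarrow> p * cnj q' - q * cnj p') (up x)"
    and "(sesqui f g \<longlongrightarrow> p' * cnj q - q' * cnj p) (dn x)"
  unfolding sesqui_def[abs_def]
  by (intro tendsto_diff tendsto_mult tendsto_reflect_up tendsto_reflect_dn assms)+

lemma norm_bands_root_le:
  assumes "\<And>k. k \<in> {1..N} \<Longrightarrow> norm (z - of_real (a k)) \<le> r"
    and "\<And>k. k \<in> {1..N} \<Longrightarrow> norm (z - of_real (b k)) \<le> r"
  shows "norm (bands_root z) \<le> r ^ N"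
proof -
  have "norm (bands_root z) \<le> (\<Prod>k\<in>{1..N}. r)"
    unfolding norm_bands_root
  proof (rule prod_mono, safe)
    fix k assume k: "k \<in> {1..N}"
    have "norm (z - of_real (a k)) * norm (z - of_real (b k)) \<le> r * r"
      using assms k by (intro mult_mono) (auto intro: order.trans[OF norm_ge_zero])
    then have "sqrt (norm (z - of_real (a k)) * norm (z - of_real (b k))) \<le> sqrt (r * r)"
      by (rule real_sqrt_le_mono)
    also have "\<dots> = r" using order.trans[OF norm_ge_zero assms(1)[OF k]] by simp
    finally show "sqrt (norm (z - of_real (a k)) * norm (z - of_real (b k))) \<le> r" .
  qed simp
  then show ?thesis by simp
qed

text \<open>Distance at least 1 from the endpoints gives access to \<open>damp_lower 1\<close>; the
  upper bounds give |\<open>bands_root z\<close>| \<le> (2 |z|)^N.\<close>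

lemma eventually_at_infinity_far:
  "eventually (\<lambda>z::complex. \<forall>k\<in>{1..N}. norm (z - of_real (a k)) \<ge> 1 \<and> norm (z - of_real (b k)) \<ge> 1 \<and>
     norm (z - of_real (a k)) \<le> 2 * norm z \<and> norm (z - of_real (b k)) \<le> 2 * norm z) at_infinity"
proof -
  have "eventually (\<lambda>z. norm (z - c) \<ge> 1 \<and> norm (z - c) \<le> 2 * norm z) at_infinity" for c :: complex
    unfolding eventually_at_infinity
  proof (intro exI allI impI)
    fix z :: complex assume "norm c + 1 \<le> norm z"
    then show "norm (z - c) \<ge> 1 \<and> norm (z - c) \<le> 2 * norm z"
      using norm_triangle_ineq2[of z c] norm_triangle_ineq4[of z c] by linarith
  qed
  from eventually_conj[OF this this] show ?thesis
    by (intro eventually_ball_finite ballI) (simp, rule eventually_mono, assumption, blast)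
qed

lemma bounded_cut: "bounded cut"
  unfolding rhp_cut_def by (intro compact_imp_bounded compact_continuous_image continuous_intros compact_Icc)

lemma eventually_at_infinity_notin_cut: "eventually (\<lambda>z. z \<notin> cut) at_infinity"
proof -
  obtain B where B: "\<And>z. z \<in> cut \<Longrightarrow> norm z \<le> B" using bounded_cut by (auto simp: bounded_iff)
  show ?thesis
    unfolding eventually_at_infinity
    by (rule exI[of _ "B + 1"]) (use B in force)
qed

lemma eventually_cnj_at_infinity:
  "eventually P at_infinity \<Longrightarrow> eventually (\<lambda>z. P (cnj z)) (at_infinity :: complex filter)"
  unfolding eventually_at_infinity by (metis complex_mod_cnj)

lemma eventually_cnj_at_endpoint:
  assumes "c \<in> endpoints" "eventually P (at c within - cut)"
  shows "eventually (\<lambda>z. P (cnj z)) (at c within - cut)"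
proof -
  have c: "cnj c = c" using assms(1) by (auto simp: endpoints_def)
  have "dist (cnj z) c = dist z c" for z
    by (metis c complex_cnj_diff complex_mod_cnj dist_norm)
  then show ?thesis
    using assms(2) c cnj_in_cut_iff unfolding eventually_at
    by (metis (no_types, lifting) ComplD ComplI complex_cnj_cnj)
qed

text \<open>The product has no jumps and removable endpoints, hence is entire, and it grows at most
  like |z|^(N - 1), so Liouville's theorem applies. The last conclusion carries the positivity: up
  to \<open>- \<i>\<close> and \<open>node_sign\<close>, the value on a band is nonnegative.\<close>

lemma row_polynomial:
  assumes "row_solution f g"
  obtains p :: "complex poly" where "degree p < N"
    and "\<And>z. z \<notin> cut \<Longrightarrow> sesqui f g z * bands_root z = poly p z"
    and "\<And>k x u v. k \<in> {1..N} \<Longrightarrow> a k < x \<Longrightarrow> x < b k \<Longrightarrow> (f \<longlongrightarrow> u) (up x) \<Longrightarrow> (g \<longlongrightarrow> v) (up x) \<Longrightarrow>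
      poly p (of_real x) = - \<i> * of_real (node_sign k * (((norm u)\<^sup>2 + (norm v)\<^sup>2) * norm (bands_root (of_real x))))"
proof -
  define P where "P z = sesqui f g z * bands_root z" for z
  have band: "(P \<longlongrightarrow> L) (up x)" "(P \<longlongrightarrow> L) (dn x)"
    if k: "k \<in> {1..N}" and x: "a k < x" "x < b k" and uv: "(f \<longlongrightarrow> u) (up x)" "(g \<longlongrightarrow> v) (up x)"
      and L: "L = - \<i> * of_real (node_sign k * (((norm u)\<^sup>2 + (norm v)\<^sup>2) * norm (bands_root (of_real x))))"
    for k x u v L
  proof -
    obtain u' v' where l: "(f \<longlongrightarrow> u') (up x)" "(g \<longlongrightarrow> v') (up x)" "(f \<longlongrightarrow> v') (dn x)" "(g \<longlongrightarrow> - u') (dn x)"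
      using row_solution_band[OF assms k x] .
    have [simp]: "u' = u" "v' = v" using l uv tendsto_unique[OF up_neq_bot] by blast+
    \<comment> \<open>The limits of \<open>sesqui\<close> from above and below are opposite, and so
      are those of \<open>bands_root\<close>; hence the product has no jump on a band.\<close>
    have 1: "u * cnj (- u) - v * cnj v = - of_real ((norm u)\<^sup>2 + (norm v)\<^sup>2)"
      unfolding of_real_add complex_norm_square by simp
    have 2: "v * cnj v - (- u) * cnj u = of_real ((norm u)\<^sup>2 + (norm v)\<^sup>2)"
      unfolding of_real_add complex_norm_square by simp
    note s = sesqui_reflect_limits[OF l[simplified]]
    show "(P \<longlongrightarrow> L) (up x)"
      unfolding P_def[abs_def] L
      by (rule tendsto_eq_rhs[OF tendsto_mult[OF s(1)[unfolded 1] bands_root_limits(1)[OF k x]]])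
        (simp add: algebra_simps)
    show "(P \<longlongrightarrow> L) (dn x)"
      unfolding P_def[abs_def] L
      by (rule tendsto_eq_rhs[OF tendsto_mult[OF s(2)[unfolded 2] bands_root_limits(2)[OF k x]]])
        (simp add: algebra_simps)
  qed
  have band': "\<exists>L. (P \<longlongrightarrow> L) (up x) \<and> (P \<longlongrightarrow> L) (dn x)"
    if kx: "k \<in> {1..N}" "a k < x" "x < b k" for k x
  proof -
    obtain u v where "(f \<longlongrightarrow> u) (up x)" "(g \<longlongrightarrow> v) (up x)"
      using row_solution_band[OF assms kx] by blast
    from band[OF kx this refl] show ?thesis by (intro exI conjI)
  qed
  have gap: "\<exists>L. (P \<longlongrightarrow> L) (up x) \<and> (P \<longlongrightarrow> L) (dn x)"
    if k: "k \<in> {1..<N}" and x: "b k < x" "x < a (Suc k)" for k x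
  proof -
    obtain u where u: "norm u = 1" and "\<exists>p q. (f \<longlongrightarrow> p) (up x) \<and> (g \<longlongrightarrow> q) (up x) \<and>
        (f \<longlongrightarrow> u * p) (dn x) \<and> (g \<longlongrightarrow> cnj u * q) (dn x)"
      using row_solution_gap[OF assms k] x by metis
    then obtain p q where l: "(f \<longlongrightarrow> p) (up x)" "(g \<longlongrightarrow> q) (up x)"
        "(f \<longlongrightarrow> u * p) (dn x)" "(g \<longlongrightarrow> cnj u * q) (dn x)" by blast
    have "isCont bands_root (of_real x)"
      using gap_in_off_bands[OF k x] bands_root_holomorphic open_off_bands
      by (metis continuous_on_eq_continuous_at holomorphic_on_imp_continuous_on)
    then have r: "(bands_root \<longlongrightarrow> bands_root (of_real x)) (up x)" "(bands_root \<longlongrightarrow> bands_root (of_real x)) (dn x)"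
      unfolding isCont_def using up_le_at dn_le_at by (blast intro: tendsto_mono)+
    \<comment> \<open>\<open>f\<close> acquires \<open>u\<close> and \<open>g\<close> acquires
      \<open>cnj u\<close>. From above these factors enter conjugated through the reflection, from
      below directly, with the same result.\<close>
    have eq: "u * p * cnj q - cnj u * q * cnj p = p * cnj (cnj u * q) - q * cnj (u * p)"
      by (simp add: mult_ac)
    show ?thesis
      using tendsto_mult[OF sesqui_reflect_limits(1)[OF l] r(1)]
        tendsto_mult[OF sesqui_reflect_limits(2)[OF l] r(2)]
      unfolding P_def[abs_def] eq by blast
  qed
  have ends: "\<exists>B. eventually (\<lambda>z. norm (P z) * sqrt (norm (z - c)) \<le> B) (at c within - cut)"
    if c: "c \<in> endpoints" for c
  proof -
    have cr: "cnj c = c" using c by (auto simp: endpoints_def)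
    obtain B where B: "eventually (\<lambda>z. norm (f z) * norm (z - c) powr (1/4) \<le> B \<and>
        norm (g z) * norm (z - c) powr (1/4) \<le> B) (at c within - cut)"
      using row_solution_endpoint[OF assms c] by blast
    have nc: "norm (cnj z - c) = norm (z - c)" for z
      by (metis cr complex_cnj_diff complex_mod_cnj)
    \<comment> \<open>The vanishing of the root at \<open>c\<close> is used only to discard it: the
      square-root bound for \<open>sesqui\<close> already suffices.\<close>
    have "eventually (\<lambda>z. norm (bands_root z) < 1) (at c within - cut)"
      using isCont_norm_bands_root[of c] bands_root_endpoint[OF c]
      by (intro order_tendstoD(2)[of _ 0]) (auto simp: isCont_def intro: tendsto_within_subset)
    with B eventually_cnj_at_endpoint[OF c B]
    have "eventually (\<lambda>z. norm (P z) * sqrt (norm (z - c)) \<le> 2 * (B * B)) (at c within - cut)"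
    proof eventually_elim
      case (elim z)
      have e: "norm (f z * cnj (g (cnj z))) * sqrt (norm (z - c)) \<le> B * B"
        "norm (g z * cnj (f (cnj z))) * sqrt (norm (z - c)) \<le> B * B"
        using elim by (auto intro!: quarter_root_product simp: nc)
      have "norm (sesqui f g z) * sqrt (norm (z - c)) \<le>
          (norm (f z * cnj (g (cnj z))) + norm (g z * cnj (f (cnj z)))) * sqrt (norm (z - c))"
        unfolding sesqui_def by (intro mult_right_mono norm_triangle_ineq4) simp
      also have "\<dots> \<le> 2 * (B * B)" using e by (simp add: distrib_right)
      finally have s: "norm (sesqui f g z) * sqrt (norm (z - c)) \<le> 2 * (B * B)" .
      have "norm (P z) * sqrt (norm (z - c)) = (norm (sesqui f g z) * sqrt (norm (z - c))) * norm (bands_root z)"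
        by (simp add: P_def norm_mult mult_ac)
      also have "\<dots> \<le> (norm (sesqui f g z) * sqrt (norm (z - c))) * 1"
        using elim by (intro mult_left_mono) auto
      finally show ?case using s by simp
    qed
    then show ?thesis by blast
  qed
  have "P holomorphic_on - cut"
    unfolding P_def[abs_def] using row_solution_holomorphic[OF assms] cut_compl_subset_off_bands
    by (intro holomorphic_intros sesqui_holomorphic holomorphic_on_subset[OF bands_root_holomorphic]) auto
  then obtain h where h: "h holomorphic_on UNIV" "\<And>z. z \<notin> cut \<Longrightarrow> h z = P z"
    by (rule entire_extension[OF _ band' gap ends]) blast+
  obtain B where B: "eventually (\<lambda>z. norm (g z) * norm z \<le> B) at_infinity"
    using row_solution_infinity(2)[OF assms] by blast
  have f2: "eventually (\<lambda>z. norm (f z) < 2) at_infinity"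
  proof -
    have "((\<lambda>z. norm (f z)) \<longlongrightarrow> 1) at_infinity" using tendsto_norm[OF row_solution_infinity(1)[OF assms]] by simp
    then show ?thesis by (rule order_tendstoD(2)) simp
  qed
  \<comment> \<open>Each of the two terms of \<open>sesqui\<close> is at most 2 B / |z|, and the
    root is at most (2 |z|)^N; \<open>N \<ge> 1\<close> allows one power of |z| to be
    cancelled.\<close>
  have "eventually (\<lambda>z. norm (h z) \<le> 4 * B * 2 ^ N * norm z ^ (N - 1)) at_infinity"
    using B f2 eventually_cnj_at_infinity[OF B] eventually_cnj_at_infinity[OF f2]
      eventually_at_infinity_notin_cut eventually_at_infinity_far
      eventually_not_equal_at_infinity[of 0]
  proof eventually_elim
    case (elim z)
    have nz: "norm z > 0" using elim by simp
    have B0: "B \<ge> 0" using elim(1) order.trans[OF _ elim(1), of 0] by simp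
    have gb: "norm (g z) \<le> B / norm z" "norm (g (cnj z)) \<le> B / norm z"
      using elim nz by (simp_all add: field_simps)
    have "norm (sesqui f g z) \<le> norm (f z) * norm (g (cnj z)) + norm (g z) * norm (f (cnj z))"
      unfolding sesqui_def using norm_triangle_ineq4[of "f z * cnj (g (cnj z))" "g z * cnj (f (cnj z))"]
      by (simp add: norm_mult)
    also have "\<dots> \<le> 2 * (B / norm z) + (B / norm z) * 2"
      using gb elim B0 nz by (intro add_mono mult_mono) auto
    finally have s: "norm (sesqui f g z) \<le> 4 * B / norm z" by simp
    have "norm (h z) = norm (sesqui f g z) * norm (bands_root z)"
      using elim h(2)[of z] by (simp add: P_def norm_mult)
    also have "\<dots> \<le> (4 * B / norm z) * (2 * norm z) ^ N"
      using s elim nz B0 by (intro mult_mono norm_bands_root_le) auto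
    also have "\<dots> = 4 * B * 2 ^ N * norm z ^ (N - 1)"
      using N_ge_1 nz by (cases N) (auto simp: power_mult_distrib)
    finally show ?case .
  qed
  then obtain A where A: "\<And>z. A \<le> norm z \<Longrightarrow> norm (h z) \<le> 4 * B * 2 ^ N * norm z ^ (N - 1)"
    unfolding eventually_at_infinity by blast
  define p where "p = (\<Sum>k\<le>N-1. monom ((deriv ^^ k) h 0 / fact k) k)"
  have hp: "h z = poly p z" for z
    using Liouville_polynomial[OF h(1) A, where \<xi> = z] by (simp add: p_def poly_sum poly_monom)
  have "degree p \<le> N - 1"
    unfolding p_def by (intro degree_sum_le) (auto intro: order.trans[OF degree_monom_le])
  then have deg: "degree p < N" using N_ge_1 by simp
  have eq: "P z = poly p z" if "z \<notin> cut" for z using h(2)[OF that] hp by simp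
  show thesis
  proof (rule that[OF deg])
    show "sesqui f g z * bands_root z = poly p z" if "z \<notin> cut" for z
      using eq[OF that] by (simp add: P_def)
    fix k x u v
    assume *: "k \<in> {1..N}" "a k < x" "x < b k" "(f \<longlongrightarrow> u) (up x)" "(g \<longlongrightarrow> v) (up x)"
    \<comment> \<open>On the cut the values of \<open>P\<close> carry no information, so the value
      of the polynomial there is identified through the limit from above.\<close>
    have "(poly p \<longlongrightarrow> poly p (of_real x)) (up x)"
      using poly_isCont[of "of_real x" p] up_le_at unfolding isCont_def by (blast intro: tendsto_mono)
    then have "(P \<longlongrightarrow> poly p (of_real x)) (up x)"
      by (rule Lim_transform_eventually)
        (use eventually_up_Im[of x] in eventually_elim, simp add: eq nonreal_notin_cut)
    then show "poly p (of_real x) = - \<i> * of_real (node_sign k * (((norm u)\<^sup>2 + (norm v)\<^sup>2) * norm (bands_root (of_real x))))"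
      using band(1)[OF * refl] tendsto_unique[OF up_neq_bot] by blast
  qed
qed

text \<open>The signs \<open>node_sign k\<close> are those of the Lagrange denominators, so for such polynomials the
  terms in the divided difference computing the leading coefficient cannot cancel.\<close>

definition alternating :: "complex poly \<Rightarrow> bool" where
  "alternating p \<longleftrightarrow> degree p < N \<and>
     (\<forall>k\<in>{1..N}. \<forall>x\<in>{a k<..<b k}. \<exists>w\<ge>0. poly p (of_real x) = - \<i> * of_real (node_sign k * w))"

section \<open>Divided differences of alternating polynomials\<close>

definition width :: real where "width = b N - a 1"

lemma width_pos: "width > 0"
  using a_1_less_b_N by (simp add: width_def)

lemma node_less:
  assumes "\<And>k. k \<in> {1..N} \<Longrightarrow> a k < c k \<and> c k < b k" "j \<in> {1..N}" "k \<in> {1..N}" "j < k"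
  shows "c j < c k"
  using assms(1)[OF assms(2)] assms(1)[OF assms(3)] b_less_a[of j k] assms(2-4) by auto

lemma inj_nodes:
  assumes "\<And>k. k \<in> {1..N} \<Longrightarrow> a k < c k \<and> c k < b k"
  shows "inj_on (\<lambda>k. complex_of_real (c k)) {1..N}"
proof (rule inj_onI)
  fix j k assume "j \<in> {1..N}" "k \<in> {1..N}" "complex_of_real (c j) = complex_of_real (c k)"
  then show "j = k"
    using node_less[OF assms, of j k] node_less[OF assms, of k j] by (cases j k rule: linorder_cases) auto
qed

text \<open>The Lagrange denominator at node \<open>k\<close> has sign \<open>node_sign k\<close>,
  so every term of the divided difference is \<open>- \<i>\<close> times a nonnegative number and
  norms add up. The nodes are arbitrary, one in each band; this freedom is used next.\<close>

lemma alternating_lead_coeff: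
  assumes p: "alternating p" and c: "\<And>k. k \<in> {1..N} \<Longrightarrow> a k < c k \<and> c k < b k"
  shows "norm (coeff p (N - 1)) = (\<Sum>k\<in>{1..N}. norm (poly p (of_real (c k))) / (\<Prod>j\<in>{1..N}-{k}. \<bar>c k - c j\<bar>))"
proof -
  have "poly p (of_real (c k)) / (\<Prod>j\<in>{1..N}-{k}. of_real (c k) - of_real (c j)) =
      - \<i> * of_real (norm (poly p (of_real (c k))) / (\<Prod>j\<in>{1..N}-{k}. \<bar>c k - c j\<bar>))"
    if k: "k \<in> {1..N}" for k
  proof -
    obtain w where w: "w \<ge> 0" "poly p (of_real (c k)) = - \<i> * of_real (node_sign k * w)"
      using p k c[OF k] unfolding alternating_def by fastforce
    have ns: "node_sign k \<noteq> 0" using norm_node_sign[of k] by auto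
    have nw: "norm (poly p (of_real (c k))) = w"
      unfolding w(2) using w(1) norm_node_sign[of k] by (simp add: norm_mult)
    have "(\<Prod>j\<in>{1..N}-{k}. c k - c j) = node_sign k * (\<Prod>j\<in>{1..N}-{k}. \<bar>c k - c j\<bar>)"
      unfolding node_sign_def prod.distrib[symmetric]
    proof (rule prod.cong[OF refl])
      fix j assume "j \<in> {1..N} - {k}"
      then show "c k - c j = (if j < k then 1 else - 1) * \<bar>c k - c j\<bar>"
        using node_less[OF c, of j k] node_less[OF c, of k j] k by (cases "j < k") auto
    qed
    then have "(\<Prod>j\<in>{1..N}-{k}. complex_of_real (c k) - of_real (c j)) =
        of_real (node_sign k * (\<Prod>j\<in>{1..N}-{k}. \<bar>c k - c j\<bar>))"
      by (metis (no_types, lifting) of_real_diff of_real_prod prod.cong)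
    then show ?thesis
      using ns by (simp only: nw, simp only: w(2) of_real_mult) simp
  qed
  then have "coeff p (N - 1) = (\<Sum>k\<in>{1..N}. - \<i> * of_real (norm (poly p (of_real (c k))) / (\<Prod>j\<in>{1..N}-{k}. \<bar>c k - c j\<bar>)))"
    using coeff_Lagrange_interpolation[OF _ inj_nodes[OF c], of p] p
    by (simp add: alternating_def)
  also have "\<dots> = - \<i> * of_real (\<Sum>k\<in>{1..N}. norm (poly p (of_real (c k))) / (\<Prod>j\<in>{1..N}-{k}. \<bar>c k - c j\<bar>))"
    by (simp only: of_real_sum sum_distrib_left)
  finally have "norm (coeff p (N - 1)) = \<bar>\<Sum>k\<in>{1..N}. norm (poly p (of_real (c k))) / (\<Prod>j\<in>{1..N}-{k}. \<bar>c k - c j\<bar>)\<bar>"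
    by (simp only: norm_mult norm_minus_cancel norm_ii norm_of_real mult_1)
  then show ?thesis
    by (simp add: sum_nonneg prod_nonneg)
qed

definition mid :: "nat \<Rightarrow> real" where "mid k = (a k + b k) / 2"

lemma mid_in_band: "k \<in> {1..N} \<Longrightarrow> a k < mid k \<and> mid k < b k"
  using a_less_b[of k] by (simp add: mid_def)

text \<open>Take \<open>x\<close> as the node of its own band and midpoints elsewhere. The term of
  \<open>x\<close> is at most the whole sum, and its denominator is a product of
  \<open>N - 1\<close> distances, each at most \<open>width\<close>.\<close>

lemma alternating_band_bound:
  assumes p: "alternating p" and k: "k \<in> {1..N}" and x: "a k < x" "x < b k"
  shows "norm (poly p (of_real x)) \<le> norm (coeff p (N - 1)) * width ^ (N - 1)"
proof -
  define c where "c = mid(k := x)"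
  have c: "a j < c j \<and> c j < b j" if "j \<in> {1..N}" for j
    using mid_in_band[OF that] x by (simp add: c_def)
  have pos: "(\<Prod>j\<in>{1..N}-{i}. \<bar>c i - c j\<bar>) > 0" if "i \<in> {1..N}" for i
  proof (rule prod_pos)
    fix j assume "j \<in> {1..N} - {i}"
    then have "c i \<noteq> c j"
      using node_less[OF c _ that, of j] node_less[OF c that, of j]
      by (cases i j rule: linorder_cases) auto
    then show "0 < \<bar>c i - c j\<bar>" by simp
  qed
  define F where "F i = norm (poly p (of_real (c i))) / (\<Prod>j\<in>{1..N}-{i}. \<bar>c i - c j\<bar>)" for i
  have "F i \<ge> 0" for i
    unfolding F_def by (intro divide_nonneg_nonneg prod_nonneg) auto
  then have "F k \<le> (\<Sum>i\<in>{1..N}. F i)"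
    by (intro member_le_sum[OF k]) auto
  also have "\<dots> = norm (coeff p (N - 1))"
    unfolding F_def by (rule alternating_lead_coeff[OF p c, symmetric])
  finally have "norm (poly p (of_real (c k))) / (\<Prod>j\<in>{1..N}-{k}. \<bar>c k - c j\<bar>) \<le> norm (coeff p (N - 1))"
    unfolding F_def .
  then have "norm (poly p (of_real x)) \<le> norm (coeff p (N - 1)) * (\<Prod>j\<in>{1..N}-{k}. \<bar>c k - c j\<bar>)"
    using pos[OF k] by (simp add: divide_le_eq c_def)
  also have "\<dots> \<le> norm (coeff p (N - 1)) * width ^ (N - 1)"
  proof (rule mult_left_mono)
    have "\<bar>c k - c j\<bar> \<le> width" if j: "j \<in> {1..N}" for j
      using c[OF k] c[OF j] a_1_le[OF k] a_1_le[OF j] b_le_b_N[OF k] b_le_b_N[OF j]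
      unfolding width_def by linarith
    then have "(\<Prod>j\<in>{1..N}-{k}. \<bar>c k - c j\<bar>) \<le> (\<Prod>j\<in>{1..N}-{k}. width)"
      by (intro prod_mono) auto
    then show "(\<Prod>j\<in>{1..N}-{k}. \<bar>c k - c j\<bar>) \<le> width ^ (N - 1)" using k by simp
  qed simp
  finally show ?thesis .
qed

text \<open>The threshold for |z| is the same for all \<open>p\<close>. With midpoints as nodes,
  each basis product differs from z^(N - 1) by at most half its modulus once |z| is large, and the
  norms of the interpolation weights sum exactly to that of the leading coefficient, so the total
  error is at most half the main term.\<close>

lemma alternating_growth:
  "eventually (\<lambda>z. \<forall>p. alternating p \<longrightarrow> norm (coeff p (N - 1)) * norm z ^ (N - 1) / 2 \<le> norm (poly p z)) at_infinity"
proof -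
  define Q where "Q k z = (\<Prod>j\<in>{1..N}-{k}. z - complex_of_real (mid j))" for k z
  have Q: "eventually (\<lambda>z. norm (Q k z - z ^ (N - 1)) \<le> norm z ^ (N - 1) / 2) at_infinity"
    if k: "k \<in> {1..N}" for k
  proof -
    have "((\<lambda>z. \<Prod>j\<in>{1..N}-{k}. 1 - complex_of_real (mid j) * inverse z) \<longlongrightarrow> (\<Prod>j\<in>{1..N}-{k}. 1 - complex_of_real (mid j) * 0)) at_infinity"
      by (intro tendsto_intros tendsto_inverse_0)
    then have "((\<lambda>z. \<Prod>j\<in>{1..N}-{k}. 1 - complex_of_real (mid j) * inverse z) \<longlongrightarrow> 1) at_infinity"
      by simp
    then have "eventually (\<lambda>z. dist (\<Prod>j\<in>{1..N}-{k}. 1 - complex_of_real (mid j) * inverse z) 1 < 1/2) at_infinity"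
      by (rule tendstoD) simp
    then show ?thesis
      using eventually_not_equal_at_infinity[of 0]
    proof eventually_elim
      case (elim z)
      have "Q k z = (\<Prod>j\<in>{1..N}-{k}. z * (1 - complex_of_real (mid j) * inverse z))"
        unfolding Q_def using elim by (intro prod.cong) (auto simp: field_simps)
      also have "\<dots> = z ^ (N - 1) * (\<Prod>j\<in>{1..N}-{k}. 1 - complex_of_real (mid j) * inverse z)"
        using k by (simp add: prod.distrib)
      finally have "Q k z - z ^ (N - 1) = z ^ (N - 1) * ((\<Prod>j\<in>{1..N}-{k}. 1 - complex_of_real (mid j) * inverse z) - 1)"
        by (simp add: algebra_simps)
      then have "norm (Q k z - z ^ (N - 1)) \<le> norm z ^ (N - 1) * (1/2)"
        using elim(1) unfolding dist_norm by (simp only: norm_mult norm_power) (intro mult_left_mono; simp)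
      then show ?case by simp
    qed
  qed
  then have "eventually (\<lambda>z. \<forall>k\<in>{1..N}. norm (Q k z - z ^ (N - 1)) \<le> norm z ^ (N - 1) / 2) at_infinity"
    by (intro eventually_ball_finite) auto
  then show ?thesis
  proof (eventually_elim, intro allI impI)
    fix z p assume Qz: "\<forall>k\<in>{1..N}. norm (Q k z - z ^ (N - 1)) \<le> norm z ^ (N - 1) / 2" and p: "alternating p"
    define t where "t k = poly p (of_real (mid k)) / (\<Prod>j\<in>{1..N}-{k}. complex_of_real (mid k) - of_real (mid j))" for k
    have dN: "degree p < card {1..N}" using p by (simp add: alternating_def)
    note I = Lagrange_interpolation[OF _ inj_nodes[OF mid_in_band] dN]
    note J = coeff_Lagrange_interpolation[OF _ inj_nodes[OF mid_in_band] dN]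
    have coeff: "coeff p (N - 1) = (\<Sum>k\<in>{1..N}. t k)"
      using J by (simp add: t_def)
    have "poly p z = (\<Sum>k\<in>{1..N}. t k * Q k z)"
      by (subst I) (simp_all add: t_def Q_def poly_sum poly_prod)
    then have "poly p z - coeff p (N - 1) * z ^ (N - 1) = (\<Sum>k\<in>{1..N}. t k * (Q k z - z ^ (N - 1)))"
      unfolding coeff by (simp add: sum_distrib_right sum_subtractf right_diff_distrib)
    also have "norm \<dots> \<le> (\<Sum>k\<in>{1..N}. norm (t k) * (norm z ^ (N - 1) / 2))"
      using Qz by (intro sum_norm_le) (simp only: norm_mult, intro mult_left_mono, auto)
    also have "\<dots> = (\<Sum>k\<in>{1..N}. norm (t k)) * (norm z ^ (N - 1) / 2)"
      by (simp only: sum_distrib_right)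
    also have "(\<Sum>k\<in>{1..N}. norm (t k)) = norm (coeff p (N - 1))"
    proof -
      have "norm (t k) = norm (poly p (of_real (mid k))) / (\<Prod>j\<in>{1..N}-{k}. \<bar>mid k - mid j\<bar>)" for k
        unfolding t_def norm_divide prod_norm[symmetric] by (simp only: of_real_diff[symmetric] norm_of_real)
      then show ?thesis using alternating_lead_coeff[OF p mid_in_band] by simp
    qed
    finally have 1: "norm (poly p z - coeff p (N - 1) * z ^ (N - 1)) \<le> norm (coeff p (N - 1)) * (norm z ^ (N - 1) / 2)" .
    have 2: "norm (coeff p (N - 1) * z ^ (N - 1)) \<le> norm (poly p z) + norm (poly p z - coeff p (N - 1) * z ^ (N - 1))"
      by (metis norm_minus_commute norm_triangle_sub)
    have 3: "norm (coeff p (N - 1) * z ^ (N - 1)) = norm (coeff p (N - 1)) * norm z ^ (N - 1)"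
      by (simp add: norm_mult norm_power)
    show "norm (coeff p (N - 1)) * norm z ^ (N - 1) / 2 \<le> norm (poly p z)"
      using 1 2 unfolding 3 by simp
  qed
qed

subsection \<open>Uniform bounds for rows\<close>

definition damp :: "complex \<Rightarrow> complex" where
  "damp z = (\<Prod>k\<in>{1..N}. band_damp (a k) (b k) z)"

definition lengths :: real where "lengths = (\<Prod>k\<in>{1..N}. b k - a k)"

definition damp_lower :: "real \<Rightarrow> real" where
  "damp_lower \<epsilon> = (\<Prod>k\<in>{1..N}. \<epsilon> / (2 * (2 * \<epsilon> + (b k - a k))))"

lemma lengths_pos: "lengths > 0"
  unfolding lengths_def using a_less_b by (intro prod_pos) auto

lemma damp_lower_pos: "\<epsilon> > 0 \<Longrightarrow> damp_lower \<epsilon> > 0"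
  unfolding damp_lower_def using a_less_b
  by (intro prod_pos divide_pos_pos mult_pos_pos add_pos_pos) auto

lemma damp_holomorphic: "damp holomorphic_on off_bands"
  unfolding damp_def[abs_def]
  by (intro holomorphic_on_prod holomorphic_on_subset[OF band_damp_holomorphic] a_less_b)
    (auto simp: off_bands_def)

lemma norm_damp_le_1: "norm (damp z) \<le> 1"
  unfolding damp_def prod_norm[symmetric] by (intro prod_le_1) (auto simp: norm_band_damp_le_1)

text \<open>On the bands only |f|^2 |\<open>bands_root\<close>| is controlled. Exchanging
  \<open>damp\<close> for the root makes that control applicable to |f|
  |\<open>damp\<close>|.\<close>

lemma norm_damp_le_root: "norm (damp z) \<le> norm (bands_root z) / lengths"
proof -
  have "norm (damp z) \<le> (\<Prod>k\<in>{1..N}. norm (band_root (a k) (b k) z) / (b k - a k))"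
    unfolding damp_def prod_norm[symmetric]
    by (intro prod_mono conjI norm_band_damp_le_root a_less_b) auto
  then show ?thesis
    by (simp add: lengths_def bands_root_def prod_dividef prod_norm)
qed

lemma norm_damp_ge:
  assumes "\<epsilon> > 0"
    and "\<And>k. k \<in> {1..N} \<Longrightarrow> \<epsilon> \<le> norm (z - of_real (a k)) \<and> \<epsilon> \<le> norm (z - of_real (b k))"
  shows "damp_lower \<epsilon> \<le> norm (damp z)"
  unfolding damp_def damp_lower_def prod_norm[symmetric]
proof (rule prod_mono)
  fix k assume k: "k \<in> {1..N}"
  have "0 \<le> \<epsilon> / (2 * (2 * \<epsilon> + (b k - a k)))"
    using a_less_b[OF k] assms(1) by (intro divide_nonneg_nonneg) auto
  then show "0 \<le> \<epsilon> / (2 * (2 * \<epsilon> + (b k - a k))) \<and>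
      \<epsilon> / (2 * (2 * \<epsilon> + (b k - a k))) \<le> norm (band_damp (a k) (b k) z)"
    using norm_band_damp_ge[OF a_less_b[OF k] assms(1), of z] assms(2)[OF k] by simp
qed

text \<open>Vanishing of order 1/2 beats the fourth-root singularity of a row entry and leaves a
  factor |z - c|^(1/4). In the proof \<open>c'\<close> is the other endpoint of the band of
  \<open>c\<close>.\<close>

lemma bands_root_endpoint_bound:
  assumes "c \<in> endpoints"
  shows "\<exists>B>0. eventually (\<lambda>z. norm (bands_root z) \<le> B * sqrt (norm (z - c))) (at c)"
proof -
  obtain k c' where k: "k \<in> {1..N}"
    and cc: "\<And>z. norm (z - of_real (a k)) * norm (z - of_real (b k)) = norm (z - c) * norm (z - c')"
  proof -
    from assms consider k where "k \<in> {1..N}" "c = of_real (a k)" | k where "k \<in> {1..N}" "c = of_real (b k)"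
      by (auto simp: endpoints_def)
    then show thesis
    proof cases
      case (1 k)
      then show thesis using that[of k "of_real (b k)"] by simp
    next
      case (2 k)
      then show thesis using that[of k "of_real (a k)"] by (simp add: mult.commute)
    qed
  qed
  define R where "R z = sqrt (norm (z - c')) *
    (\<Prod>j\<in>{1..N}-{k}. sqrt (norm (z - of_real (a j)) * norm (z - of_real (b j))))" for z
  have eq: "norm (bands_root z) = sqrt (norm (z - c)) * R z" for z
    unfolding norm_bands_root R_def using k
    by (subst prod.remove[of _ k]) (auto simp: cc real_sqrt_mult)
  have R0: "R z \<ge> 0" for z unfolding R_def by (intro mult_nonneg_nonneg prod_nonneg) auto
  have "isCont R c" unfolding R_def by (intro continuous_intros)
  then have "eventually (\<lambda>z. R z < R c + 1) (at c)"
    unfolding isCont_def by (rule order_tendstoD) simp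
  then have "eventually (\<lambda>z. norm (bands_root z) \<le> (R c + 1) * sqrt (norm (z - c))) (at c)"
    by eventually_elim (simp add: eq mult.commute mult_right_mono)
  then show ?thesis using R0[of c] by (intro exI[of _ "R c + 1"]) auto
qed

text \<open>The modulus of \<open>f\<close> is single valued across the gaps although \<open>f\<close> is not.\<close>

lemma damped_bound:
  assumes hol: "f holomorphic_on - cut" and Q: "Q \<ge> 0"
    and band: "\<And>k x. k \<in> {1..N} \<Longrightarrow> a k < x \<Longrightarrow> x < b k \<Longrightarrow>
      \<exists>p q. (f \<longlongrightarrow> p) (up x) \<and> (f \<longlongrightarrow> q) (dn x) \<and>
        (norm p)\<^sup>2 * norm (bands_root (of_real x)) \<le> Q \<and> (norm q)\<^sup>2 * norm (bands_root (of_real x)) \<le> Q"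
    and gap: "\<And>k. k \<in> {1..<N} \<Longrightarrow> \<exists>u. norm u = 1 \<and> (\<forall>x. b k < x \<longrightarrow> x < a (Suc k) \<longrightarrow>
      (\<exists>p. (f \<longlongrightarrow> p) (up x) \<and> (f \<longlongrightarrow> u * p) (dn x)))"
    and ends: "\<And>c. c \<in> endpoints \<Longrightarrow>
      \<exists>B. eventually (\<lambda>z. norm (f z) * norm (z - c) powr (1/4) \<le> B) (at c within - cut)"
    and inf: "(f \<longlongrightarrow> l) at_infinity" "norm l \<le> 1"
    and z: "z \<notin> cut"
  shows "norm (f z * damp z) \<le> max 1 (sqrt (Q * width ^ N) / lengths)" (is "_ \<le> ?K")
proof -
  \<comment> \<open>On a gap the modulus is read off from the upper limit; the lower one has the
    same norm. The values on bands are irrelevant, as \<open>m\<close> is used only on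
    \<open>off_bands\<close>.\<close>
  define m where "m w = (if w \<in> cut then norm (Lim (up (Re w)) f) else norm (f w))" for w
  define v where "v w = m w * norm (damp w)" for w
  have m_nonneg: "m w \<ge> 0" for w by (simp add: m_def)
  have m_real: "m (of_real y) = norm p" if "complex_of_real y \<in> cut" "(f \<longlongrightarrow> p) (up y)" for y p
    using that by (simp add: m_def tendsto_Lim)
  have gap_lim: "\<exists>p. (f \<longlongrightarrow> p) (up y)" if k: "k \<in> {1..<N}" and y: "b k < y" "y < a (Suc k)" for k y
    using gap[OF k] y by blast
  have "v z \<le> ?K"
  proof (rule maximum_principle_local_modulus[OF open_off_bands])
    show "z \<in> off_bands" using z cut_compl_subset_off_bands by auto
  next
    fix w assume w: "w \<in> off_bands"
    show "\<exists>e>0. \<exists>g. ball w e \<subseteq> off_bands \<and> g holomorphic_on ball w e \<and>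
        (\<forall>s\<in>ball w e. norm (g s) = v s)"
    proof (cases "w \<in> cut")
      case False
      then obtain e where e: "e > 0" "ball w e \<subseteq> - cut"
        using open_cut_compl openE by (metis ComplI)
      have "(\<lambda>s. f s * damp s) holomorphic_on ball w e"
        using e(2) cut_compl_subset_off_bands
        by (intro holomorphic_intros holomorphic_on_subset[OF hol] holomorphic_on_subset[OF damp_holomorphic]) auto
      moreover have "norm (f s * damp s) = v s" if "s \<in> ball w e" for s
        using e(2) that by (auto simp: v_def m_def norm_mult)
      ultimately show ?thesis using e cut_compl_subset_off_bands by blast
    next
      case True
      then obtain x k where wx: "w = of_real x" and k: "k \<in> {1..<N}" and x: "b k < x" "x < a (Suc k)"
        using off_bands_in_cut[OF w] by metis
      obtain u where u: "norm u = 1" and ul: "\<And>y. b k < y \<Longrightarrow> y < a (Suc k) \<Longrightarrow>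
          \<exists>p. (f \<longlongrightarrow> p) (up y) \<and> (f \<longlongrightarrow> u * p) (dn y)"
        using gap[OF k] by blast
      define e where "e = min (x - b k) (a (Suc k) - x)"
      have e: "e > 0" using x by (simp add: e_def)
      have in_gap: "b k < y \<and> y < a (Suc k)" if "complex_of_real y \<in> ball w e" for y
      proof -
        have "\<bar>x - y\<bar> < e" using that unfolding wx by (simp add: dist_of_real dist_real_def)
        then show ?thesis by (auto simp: e_def)
      qed
      have real_of: "\<exists>y. s = of_real y" if "Im s = 0" for s
        using that by (metis Reals_cases complex_is_Real_iff)
      define S where "S = ball w e"
      \<comment> \<open>Rotating the lower half by \<open>cnj u\<close> cancels the phase without
        changing the modulus. After gluing, this is the local holomorphic function of modulus
        \<open>m\<close> required by the maximum principle.\<close>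
      define F where "F s = (if Im s < 0 then cnj u * f s else f s)" for s
      have opens: "open (S \<inter> {s. Im s < 0})" "open (S \<inter> {s. Im s > 0})"
        unfolding S_def by (auto intro: open_halfspace_Im_lt open_halfspace_Im_gt)
      have "F holomorphic_on (S \<inter> {s. Im s < 0})"
        by (rule holomorphic_transform[of "\<lambda>s. cnj u * f s"])
          (use nonreal_notin_cut in \<open>auto simp: F_def intro!: holomorphic_intros holomorphic_on_subset[OF hol]\<close>)
      moreover have "F holomorphic_on (S \<inter> {s. Im s > 0})"
        by (rule holomorphic_transform[of f])
          (use nonreal_notin_cut in \<open>auto simp: F_def intro!: holomorphic_on_subset[OF hol]\<close>)
      ultimately have "F holomorphic_on (S \<inter> {s. Im s < 0} \<union> S \<inter> {s. Im s > 0})"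
        using opens by (rule holomorphic_on_Un)
      then have F_hol: "F holomorphic_on (S - \<real>)"
        by (rule holomorphic_on_subset) (auto simp: complex_is_Real_iff)
      have F_lim: "\<exists>L. (F \<longlongrightarrow> L) (up y) \<and> (F \<longlongrightarrow> L) (dn y)" if y: "of_real y \<in> S" for y
      proof -
        obtain p where p: "(f \<longlongrightarrow> p) (up y)" "(f \<longlongrightarrow> u * p) (dn y)"
          using ul[of y] in_gap[of y] y by (auto simp: S_def)
        have "cnj u * (u * p) = (u * cnj u) * p" by (simp add: mult_ac)
        also have "\<dots> = p" using u by (simp flip: complex_norm_square)
        finally have cu: "cnj u * (u * p) = p" .
        have "(F \<longlongrightarrow> p) (up y)"
          using p(1) by (rule Lim_transform_eventually)
            (use eventually_up_Im[of y] in eventually_elim, simp add: F_def)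
        moreover have "(F \<longlongrightarrow> cnj u * (u * p)) (dn y)"
          using tendsto_mult[OF tendsto_const p(2), of "cnj u"]
          by (rule Lim_transform_eventually)
            (use eventually_dn_Im[of y] in eventually_elim, simp add: F_def)
        ultimately show ?thesis unfolding cu by blast
      qed
      obtain h where h: "h holomorphic_on S" "\<And>s. s \<in> S \<Longrightarrow> Im s \<noteq> 0 \<Longrightarrow> h s = F s"
        by (rule holomorphic_glue_real_line[OF _ F_hol F_lim]) (auto simp: S_def)
      have sub: "S \<subseteq> off_bands"
      proof
        fix s assume s: "s \<in> S"
        show "s \<in> off_bands"
        proof (cases "Im s = 0")
          case True
          then obtain y where "s = of_real y" using real_of by blast
          then show ?thesis using in_gap[of y] s gap_in_off_bands[OF k] by (auto simp: S_def)
        next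
          case False
          then show ?thesis using nonreal_notin_cut cut_compl_subset_off_bands by blast
        qed
      qed
      have hm: "norm (h s) = m s" if s: "s \<in> S" for s
      proof (cases "Im s = 0")
        case False
        then show ?thesis
          using h(2)[OF s] u nonreal_notin_cut[of s] by (simp add: m_def F_def norm_mult)
      next
        case True
        then obtain y where y: "s = of_real y" using real_of by blast
        have yg: "b k < y" "y < a (Suc k)" using in_gap[of y] s y by (auto simp: S_def)
        have ycut: "complex_of_real y \<in> cut"
          using yg a_1_le[of "Suc k"] a_1_le[of k] b_le_b_N[of "Suc k"] k
            a_less_b[of k] a_less_b[of "Suc k"] unfolding of_real_in_cut_iff by auto
        have "isCont h s"
          using h(1) s by (metis S_def continuous_on_eq_continuous_at holomorphic_on_imp_continuous_on open_ball)
        then have "(h \<longlongrightarrow> h s) (up y)"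
          using up_le_at unfolding isCont_def y by (rule tendsto_mono[rotated])
        moreover have "eventually (\<lambda>t. t \<in> S) (up y)"
          using s unfolding y S_def by (intro eventually_at_in_open'[THEN filter_leD[OF up_le_at]]) auto
        then have "eventually (\<lambda>t. h t = f t) (up y)"
          using eventually_up_Im[of y] by eventually_elim (simp add: h(2) F_def)
        ultimately have "(f \<longlongrightarrow> h s) (up y)" by (rule Lim_transform_eventually)
        then show ?thesis using m_real[OF ycut] y by simp
      qed
      have "(\<lambda>s. h s * damp s) holomorphic_on S"
        using h(1) sub by (intro holomorphic_intros holomorphic_on_subset[OF damp_holomorphic])
      moreover have "norm (h s * damp s) = v s" if "s \<in> S" for s
        using hm[OF that] by (simp add: v_def norm_mult)
      ultimately show ?thesis using e sub unfolding S_def by blast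
    qed
  next
    fix p K' assume p: "p \<notin> off_bands" and K': "?K < K'"
    then obtain k x where k: "k \<in> {1..N}" and px: "p = of_real x" and x: "a k \<le> x" "x \<le> b k"
      by (auto simp: off_bands_def)
    have v_le: "v s \<le> m s * norm (bands_root s) / lengths" for s
      using mult_left_mono[OF norm_damp_le_root m_nonneg] by (simp add: v_def)
    show "eventually (\<lambda>s. v s < K') (at p within off_bands)"
    proof (cases "a k < x \<and> x < b k")
      case True
      have lim_lt: "eventually (\<lambda>s. norm (f s) * norm (bands_root s) / lengths < K') F"
        if q: "(norm q)\<^sup>2 * norm (bands_root (of_real x)) \<le> Q" and fl: "(f \<longlongrightarrow> q) F"
          and F: "F \<le> at (of_real x)" for q F
      proof -
        have "norm (bands_root (of_real x)) \<le> width ^ N"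
        proof (rule norm_bands_root_le)
          fix j assume j: "j \<in> {1..N}"
          have xx: "a 1 \<le> x" "x \<le> b N" using a_1_le[OF k] b_le_b_N[OF k] x by auto
          show "norm (complex_of_real x - of_real (a j)) \<le> width"
            unfolding of_real_diff[symmetric] norm_of_real width_def
            using xx a_1_le[OF j] a_less_b[OF j] b_le_b_N[OF j] by linarith
          show "norm (complex_of_real x - of_real (b j)) \<le> width"
            unfolding of_real_diff[symmetric] norm_of_real width_def
            using xx a_1_le[OF j] a_less_b[OF j] b_le_b_N[OF j] by linarith
        qed
        \<comment> \<open>With R the root at \<open>x\<close>, the square of |q| |R| is (|q|^2 |R|)
          |R|: the first factor is at most \<open>Q\<close>, the second at most
          \<open>width ^ N\<close>.\<close>
        then have "((norm q)\<^sup>2 * norm (bands_root (of_real x))) * norm (bands_root (of_real x)) \<le> Q * width ^ N"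
          using q Q by (intro mult_mono) auto
        then have "(norm q * norm (bands_root (of_real x)))\<^sup>2 \<le> Q * width ^ N"
          by (simp add: power2_eq_square mult_ac)
        then have "norm q * norm (bands_root (of_real x)) \<le> sqrt (Q * width ^ N)"
          by (rule real_le_rsqrt)
        then have "norm q * norm (bands_root (of_real x)) / lengths \<le> sqrt (Q * width ^ N) / lengths"
          using lengths_pos by (intro divide_right_mono) auto
        also have "\<dots> < K'" using K' by simp
        finally have lt: "norm q * norm (bands_root (of_real x)) / lengths < K'" .
        have "((\<lambda>s. norm (bands_root s)) \<longlongrightarrow> norm (bands_root (of_real x))) F"
          using isCont_norm_bands_root F unfolding isCont_def by (blast intro: tendsto_mono)
        then have "((\<lambda>s. norm (f s) * norm (bands_root s) / lengths) \<longlongrightarrow> norm q * norm (bands_root (of_real x)) / lengths) F"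
          using lengths_pos by (intro tendsto_divide tendsto_mult tendsto_norm[OF fl] tendsto_const) auto
        then show ?thesis using lt by (rule order_tendstoD)
      qed
      obtain q q' where q: "(f \<longlongrightarrow> q) (up x)" "(f \<longlongrightarrow> q') (dn x)"
        "(norm q)\<^sup>2 * norm (bands_root (of_real x)) \<le> Q" "(norm q')\<^sup>2 * norm (bands_root (of_real x)) \<le> Q"
        using band[OF k] True by blast
      obtain d1 where d1: "d1 > 0" "\<And>s. s \<in> ball (of_real x) d1 \<Longrightarrow> Im s > 0 \<Longrightarrow>
          norm (f s) * norm (bands_root s) / lengths < K'"
        using lim_lt[OF q(3) q(1) up_le_at] by (auto elim: eventually_up_ball)
      obtain d2 where d2: "d2 > 0" "\<And>s. s \<in> ball (of_real x) d2 \<Longrightarrow> Im s < 0 \<Longrightarrow>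
          norm (f s) * norm (bands_root s) / lengths < K'"
        using lim_lt[OF q(4) q(2) dn_le_at] by (auto elim: eventually_dn_ball)
      define d where "d = min (min d1 d2) (min (x - a k) (b k - x))"
      have d: "d > 0" using d1 d2 True by (simp add: d_def)
      have "v s < K'" if s: "s \<in> off_bands" "s \<in> ball (of_real x) d" for s
      proof -
        \<comment> \<open>A real point this close to \<open>x\<close> would lie on band
          \<open>k\<close>, hence outside \<open>off_bands\<close>. So \<open>s\<close> is off the
          cut and \<open>m s\<close> is the modulus of \<open>f\<close> itself.\<close>
        have "Im s \<noteq> 0"
        proof
          assume "Im s = 0"
          then obtain y where y: "s = of_real y" by (metis Reals_cases complex_is_Real_iff)
          have "\<bar>x - y\<bar> < d" using s(2) unfolding y by (simp add: dist_of_real dist_real_def)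
          then have "y \<in> {a k..b k}" by (auto simp: d_def)
          then show False using s(1) k unfolding off_bands_def y by blast
        qed
        then have "norm (f s) * norm (bands_root s) / lengths < K'" and "m s = norm (f s)"
          using d1(2)[of s] d2(2)[of s] s(2) nonreal_notin_cut[of s]
          by (cases "Im s > 0"; simp add: d_def m_def)+
        then show ?thesis using v_le[of s] by simp
      qed
      then show ?thesis unfolding eventually_at px using d by (auto simp: dist_commute intro!: exI[of _ d])
    next
      case False
      then have c: "p \<in> endpoints" using x k px by (auto simp: endpoints_def)
      obtain B where "eventually (\<lambda>z. norm (f z) * norm (z - p) powr (1/4) \<le> B) (at p within - cut)"
        using ends[OF c] by blast
      then obtain d where d: "d > 0" "\<And>s. s \<notin> cut \<Longrightarrow> s \<noteq> p \<Longrightarrow> dist s p < d \<Longrightarrow>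
          norm (f s) * norm (s - p) powr (1/4) \<le> B"
        unfolding eventually_at by blast
      have pcut: "p \<in> cut" using c endpoints_subset_cut by auto
      \<comment> \<open>Points of \<open>off_bands\<close> near an endpoint may lie in a gap, where
        the fourth-root bound has to be obtained as a limit from above.\<close>
      have mB: "m s * norm (s - p) powr (1/4) \<le> B" if s: "s \<in> off_bands" "s \<in> ball p d" for s
      proof (cases "s \<in> cut")
        case False
        then show ?thesis using d(2)[of s] s pcut by (auto simp: m_def dist_commute)
      next
        case True
        then obtain y j where y: "s = of_real y" "j \<in> {1..<N}" "b j < y" "y < a (Suc j)"
          using off_bands_in_cut[OF s(1)] by metis
        obtain q where q: "(f \<longlongrightarrow> q) (up y)" using gap_lim[OF y(2-4)] by blast
        have sp: "s \<noteq> p" using s(1) p by auto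
        have "((\<lambda>t. norm (f t) * norm (t - p) powr (1/4)) \<longlongrightarrow> norm q * norm (s - p) powr (1/4)) (up y)"
          unfolding y(1) by (intro tendsto_intros q) (use sp y(1) in auto)
        moreover have "eventually (\<lambda>t. t \<in> ball p d) (up y)"
          using s(2) unfolding y(1) by (intro eventually_at_in_open'[THEN filter_leD[OF up_le_at]]) auto
        then have "eventually (\<lambda>t. norm (f t) * norm (t - p) powr (1/4) \<le> B) (up y)"
          using eventually_up_Im[of y]
        proof eventually_elim
          case (elim t)
          then show ?case using d(2)[of t] nonreal_notin_cut[of t] pcut by (auto simp: dist_commute)
        qed
        ultimately have "norm q * norm (s - p) powr (1/4) \<le> B" by (intro tendsto_upperbound) auto
        then show ?thesis using m_real[of y q] q True y(1) by simp
      qed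
      obtain C where C: "C > 0" "eventually (\<lambda>z. norm (bands_root z) \<le> C * sqrt (norm (z - p))) (at p)"
        using bands_root_endpoint_bound[OF c] by blast
      have C2: "eventually (\<lambda>z. norm (bands_root z) \<le> C * sqrt (norm (z - p))) (at p within off_bands)"
        using C(2) by (rule filter_leD[OF at_le, rotated]) simp
      have "((\<lambda>s. norm (s - p)) \<longlongrightarrow> norm (p - p)) (at p within off_bands)"
        by (intro tendsto_intros)
      then have n0: "((\<lambda>s. norm (s - p)) \<longlongrightarrow> 0) (at p within off_bands)" by simp
      have "((\<lambda>s. norm (s - p) powr (1/4)) \<longlongrightarrow> 0 powr (1/4)) (at p within off_bands)"
        by (rule tendsto_powr'[OF n0 tendsto_const]) auto
      then have "((\<lambda>s. norm (s - p) powr (1/4)) \<longlongrightarrow> 0) (at p within off_bands)" by simp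
      then have "((\<lambda>s. B * C / lengths * norm (s - p) powr (1/4)) \<longlongrightarrow> 0) (at p within off_bands)"
        by (rule tendsto_mult_right_zero)
      then have lt: "eventually (\<lambda>s. B * C / lengths * norm (s - p) powr (1/4) < K') (at p within off_bands)"
        by (rule order_tendstoD) (use K' in simp)
      have "eventually (\<lambda>s. s \<in> off_bands \<and> s \<in> ball p d) (at p within off_bands)"
        unfolding eventually_at using d(1) by (auto simp: dist_commute intro!: exI[of _ d])
      with C2 lt show ?thesis
      proof eventually_elim
        case (elim s)
        let ?r = "norm (s - p) powr (1/4)"
        have r: "?r * ?r = sqrt (norm (s - p))" by (rule powr_quarter_square) simp
        \<comment> \<open>The root is O(?r ^ 2): one factor \<open>?r\<close> absorbs the
          singularity of \<open>m\<close>, the other tends to \<open>0\<close>.\<close>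
        have "m s * norm (bands_root s) \<le> m s * (C * (?r * ?r))"
          using elim m_nonneg unfolding r by (intro mult_left_mono) auto
        also have "\<dots> = (m s * ?r) * (C * ?r)" by (simp add: mult_ac)
        also have "\<dots> \<le> B * (C * ?r)"
          using mB elim C(1) by (intro mult_right_mono) auto
        finally have "m s * norm (bands_root s) / lengths \<le> B * (C * ?r) / lengths"
          using lengths_pos by (intro divide_right_mono) auto
        then have "v s \<le> B * C / lengths * ?r" using v_le[of s] by (simp add: mult_ac)
        then show ?case using elim by linarith
      qed
    qed
  next
    \<comment> \<open>The \<open>1\<close> in the bound comes from here: near infinity nothing is
      known beyond |\<open>l\<close>| \<le> 1 and |\<open>damp\<close>| \<le> 1.\<close>
    fix K' assume K': "?K < K'"
    have "((\<lambda>s. norm (f s)) \<longlongrightarrow> norm l) at_infinity" using inf(1) by (rule tendsto_norm)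
    then have "eventually (\<lambda>s. norm (f s) < K') at_infinity"
      by (rule order_tendstoD) (use inf(2) K' in linarith)
    with eventually_at_infinity_notin_cut
    show "eventually (\<lambda>s. s \<in> off_bands \<longrightarrow> v s < K') at_infinity"
    proof eventually_elim
      case (elim s)
      have "v s \<le> norm (f s) * 1"
        unfolding v_def using elim norm_damp_le_1[of s] by (intro mult_mono) (auto simp: m_def)
      then show ?case using elim by simp
    qed
  qed
  then show ?thesis using z by (simp add: v_def m_def norm_mult)
qed

text \<open>The part of the bound in \<open>damped_bound\<close> that does not depend on the row:
  with Q = \<gamma> width^(N - 1), the quantity sqrt (Q width^N) / lengths becomes sqrt \<gamma>
  times \<open>weight\<close>.\<close>

definition weight :: real where
  "weight = sqrt (width ^ (N - 1) * width ^ N) / lengths"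

lemma weight_nonneg: "weight \<ge> 0"
  using lengths_pos width_pos by (simp add: weight_def)

lemma row_solution_tendsto_0:
  assumes "row_solution f g"
  shows "(g \<longlongrightarrow> 0) at_infinity"
proof -
  obtain B where "eventually (\<lambda>z. norm (g z) * norm z \<le> B) at_infinity"
    using row_solution_infinity(2)[OF assms] by blast
  then have "eventually (\<lambda>z. norm (g z) \<le> B * norm (inverse z)) at_infinity"
    using eventually_not_equal_at_infinity[of 0]
    by eventually_elim (simp add: norm_inverse pos_le_divide_eq flip: divide_inverse)
  moreover have "((\<lambda>z::complex. B * norm (inverse z)) \<longlongrightarrow> 0) at_infinity"
    by (intro tendsto_mult_right_zero tendsto_norm_zero tendsto_inverse_0)
  ultimately show ?thesis by (rule Lim_null_comparison)
qed

text \<open>On a band the four one-sided limits of \<open>f\<close> and \<open>g\<close> are u, v, v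
  and -u, and the polynomial is (|u|^2 + |v|^2) times the root in modulus, so
  \<open>alternating_band_bound\<close> controls all four. The resulting bound sees the row only
  through the leading coefficient.\<close>

lemma row_damped_bound:
  assumes row: "row_solution f g"
  obtains p where "alternating p"
    and "\<And>z. z \<notin> cut \<Longrightarrow> sesqui f g z * bands_root z = poly p z"
    and "\<And>z. z \<notin> cut \<Longrightarrow> norm (f z * damp z) \<le> max 1 (sqrt (norm (coeff p (N - 1))) * weight)"
    and "\<And>z. z \<notin> cut \<Longrightarrow> norm (g z * damp z) \<le> max 1 (sqrt (norm (coeff p (N - 1))) * weight)"
proof -
  obtain p where deg: "degree p < N"
    and eq: "\<And>z. z \<notin> cut \<Longrightarrow> sesqui f g z * bands_root z = poly p z"
    and val: "\<And>k x u v. k \<in> {1..N} \<Longrightarrow> a k < x \<Longrightarrow> x < b k \<Longrightarrow> (f \<longlongrightarrow> u) (up x) \<Longrightarrow> (g \<longlongrightarrow> v) (up x) \<Longrightarrow>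
      poly p (of_real x) = - \<i> * of_real (node_sign k * (((norm u)\<^sup>2 + (norm v)\<^sup>2) * norm (bands_root (of_real x))))"
    by (rule row_polynomial[OF row]) blast
  have alt: "alternating p"
    unfolding alternating_def
  proof (intro conjI deg ballI)
    fix k x assume k: "k \<in> {1..N}" and x: "x \<in> {a k<..<b k}"
    then have x': "a k < x" "x < b k" by auto
    obtain u v where uv: "(f \<longlongrightarrow> u) (up x)" "(g \<longlongrightarrow> v) (up x)"
      using row_solution_band[OF row k x'] by blast
    show "\<exists>w\<ge>0. poly p (of_real x) = - \<i> * of_real (node_sign k * w)"
      by (rule exI[of _ "((norm u)\<^sup>2 + (norm v)\<^sup>2) * norm (bands_root (of_real x))"])
        (use val[OF k x' uv] in auto)
  qed
  define \<gamma> where "\<gamma> = norm (coeff p (N - 1))"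
  define Q where "Q = \<gamma> * width ^ (N - 1)"
  have \<gamma>0: "\<gamma> \<ge> 0" by (simp add: \<gamma>_def)
  have Q0: "Q \<ge> 0" unfolding Q_def using \<gamma>0 width_pos by simp
  have K: "sqrt (Q * width ^ N) / lengths = sqrt \<gamma> * weight"
    by (simp add: Q_def weight_def real_sqrt_mult mult.assoc)
  have band: "\<exists>u v. (f \<longlongrightarrow> u) (up x) \<and> (g \<longlongrightarrow> v) (up x) \<and> (f \<longlongrightarrow> v) (dn x) \<and> (g \<longlongrightarrow> - u) (dn x) \<and>
      (norm u)\<^sup>2 * norm (bands_root (of_real x)) \<le> Q \<and> (norm v)\<^sup>2 * norm (bands_root (of_real x)) \<le> Q"
    if k: "k \<in> {1..N}" and x: "a k < x" "x < b k" for k x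
  proof -
    obtain u v where uv: "(f \<longlongrightarrow> u) (up x)" "(g \<longlongrightarrow> v) (up x)" "(f \<longlongrightarrow> v) (dn x)" "(g \<longlongrightarrow> - u) (dn x)"
      using row_solution_band[OF row k x] by blast
    let ?r = "norm (bands_root (of_real x))"
    have "norm (poly p (of_real x)) = ((norm u)\<^sup>2 + (norm v)\<^sup>2) * ?r"
      unfolding val[OF k x uv(1,2)] norm_mult norm_minus_cancel norm_of_real abs_mult norm_node_sign by simp
    then have "((norm u)\<^sup>2 + (norm v)\<^sup>2) * ?r \<le> Q"
      using alternating_band_bound[OF alt k x] by (simp add: Q_def \<gamma>_def)
    then have "(norm u)\<^sup>2 * ?r + (norm v)\<^sup>2 * ?r \<le> Q" by (simp add: distrib_right)
    moreover have "(norm u)\<^sup>2 * ?r \<ge> 0" "(norm v)\<^sup>2 * ?r \<ge> 0" by simp_all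
    ultimately have "(norm u)\<^sup>2 * ?r \<le> Q" "(norm v)\<^sup>2 * ?r \<le> Q" by linarith+
    then show ?thesis using uv by blast
  qed
  have fb: "norm (f z * damp z) \<le> max 1 (sqrt \<gamma> * weight)" if z: "z \<notin> cut" for z
    unfolding K[symmetric]
  proof (rule damped_bound[OF row_solution_holomorphic(1)[OF row] Q0 _ _ _ row_solution_infinity(1)[OF row] _ z])
    show "\<exists>p q. (f \<longlongrightarrow> p) (up x) \<and> (f \<longlongrightarrow> q) (dn x) \<and>
        (norm p)\<^sup>2 * norm (bands_root (of_real x)) \<le> Q \<and> (norm q)\<^sup>2 * norm (bands_root (of_real x)) \<le> Q"
      if "k \<in> {1..N}" "a k < x" "x < b k" for k x
      using band[OF that] by blast
    show "\<exists>u. norm u = 1 \<and> (\<forall>x. b k < x \<longrightarrow> x < a (Suc k) \<longrightarrow>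
        (\<exists>p. (f \<longlongrightarrow> p) (up x) \<and> (f \<longlongrightarrow> u * p) (dn x)))" if "k \<in> {1..<N}" for k
      by (rule row_solution_gap[OF row that]) blast
    show "\<exists>B. eventually (\<lambda>z. norm (f z) * norm (z - c) powr (1/4) \<le> B) (at c within - cut)"
      if "c \<in> endpoints" for c
      using row_solution_endpoint[OF row that] by (auto elim: eventually_mono)
  qed simp
  note g_lim = row_solution_tendsto_0[OF row]
  have gb: "norm (g z * damp z) \<le> max 1 (sqrt \<gamma> * weight)" if z: "z \<notin> cut" for z
    unfolding K[symmetric]
  proof (rule damped_bound[OF row_solution_holomorphic(2)[OF row] Q0 _ _ _ g_lim _ z])
    show "\<exists>p q. (g \<longlongrightarrow> p) (up x) \<and> (g \<longlongrightarrow> q) (dn x) \<and>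
        (norm p)\<^sup>2 * norm (bands_root (of_real x)) \<le> Q \<and> (norm q)\<^sup>2 * norm (bands_root (of_real x)) \<le> Q"
      if kx: "k \<in> {1..N}" "a k < x" "x < b k" for k x
    proof -
      obtain u v where "(g \<longlongrightarrow> v) (up x)" "(g \<longlongrightarrow> - u) (dn x)"
        "(norm u)\<^sup>2 * norm (bands_root (of_real x)) \<le> Q" "(norm v)\<^sup>2 * norm (bands_root (of_real x)) \<le> Q"
        using band[OF kx] by blast
      then show ?thesis by (intro exI[of _ v] exI[of _ "- u"]) simp
    qed
    show "\<exists>u. norm u = 1 \<and> (\<forall>x. b k < x \<longrightarrow> x < a (Suc k) \<longrightarrow>
        (\<exists>p. (g \<longlongrightarrow> p) (up x) \<and> (g \<longlongrightarrow> u * p) (dn x)))" if k: "k \<in> {1..<N}" for k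
    proof -
      obtain u where u: "norm u = 1"
        "\<And>x. b k < x \<Longrightarrow> x < a (Suc k) \<Longrightarrow> \<exists>p q. (f \<longlongrightarrow> p) (up x) \<and> (g \<longlongrightarrow> q) (up x) \<and>
           (f \<longlongrightarrow> u * p) (dn x) \<and> (g \<longlongrightarrow> cnj u * q) (dn x)"
        by (rule row_solution_gap[OF row k]) blast
      show ?thesis
      proof (rule exI[of _ "cnj u"], intro conjI allI impI)
        show "norm (cnj u) = 1" using u(1) by simp
        fix x assume "b k < x" "x < a (Suc k)"
        then show "\<exists>p. (g \<longlongrightarrow> p) (up x) \<and> (g \<longlongrightarrow> cnj u * p) (dn x)"
          using u(2)[of x] by blast
      qed
    qed
    show "\<exists>B. eventually (\<lambda>z. norm (g z) * norm (z - c) powr (1/4) \<le> B) (at c within - cut)"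
      if "c \<in> endpoints" for c
      using row_solution_endpoint[OF row that] by (auto elim: eventually_mono)
  qed simp
  show thesis
    by (rule that[OF alt eq fb[unfolded \<gamma>_def] gb[unfolded \<gamma>_def]])
qed

text \<open>If \<open>\<gamma>\<close> is the modulus of the leading coefficient, then \<open>f - 1\<close> and \<open>g\<close> are
  \<open>O (sqrt \<gamma> / z)\<close> by the Schwarz lemma, so \<open>\<gamma> / z \<lesssim> sesqui f g z\<close> is
  \<open>O (sqrt \<gamma> / z + \<gamma> / z\<^sup>2)\<close>, which bounds \<open>\<gamma>\<close> upon choosing \<open>z\<close> large.\<close>

lemma lead_coeff_bound:
  obtains G where "G \<ge> 0"
    and "\<And>f g p. row_solution f g \<Longrightarrow> alternating p \<Longrightarrow>
      (\<And>z. z \<notin> cut \<Longrightarrow> sesqui f g z * bands_root z = poly p z) \<Longrightarrow>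
      (\<And>z. z \<notin> cut \<Longrightarrow> norm (f z * damp z) \<le> max 1 (sqrt (norm (coeff p (N - 1))) * weight)) \<Longrightarrow>
      (\<And>z. z \<notin> cut \<Longrightarrow> norm (g z * damp z) \<le> max 1 (sqrt (norm (coeff p (N - 1))) * weight)) \<Longrightarrow>
      norm (coeff p (N - 1)) \<le> G"
proof -
  obtain \<rho>1 where \<rho>1: "\<And>z. \<rho>1 \<le> norm z \<Longrightarrow>
      (\<forall>k\<in>{1..N}. norm (z - of_real (a k)) \<ge> 1 \<and> norm (z - of_real (b k)) \<ge> 1 \<and>
     norm (z - of_real (a k)) \<le> 2 * norm z \<and> norm (z - of_real (b k)) \<le> 2 * norm z) \<and> z \<notin> cut \<and>
     (\<forall>p. alternating p \<longrightarrow> norm (coeff p (N - 1)) * norm z ^ (N - 1) / 2 \<le> norm (poly p z))"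
    using eventually_conj[OF eventually_at_infinity_far
        eventually_conj[OF eventually_at_infinity_notin_cut alternating_growth]]
    unfolding eventually_at_infinity by blast
  define \<rho> where "\<rho> = max 1 \<rho>1"
  have \<rho>: "\<rho> > 0" by (simp add: \<rho>_def)
  \<comment> \<open>\<open>A0\<close> absorbs both cases of the maximum: beyond \<rho> the endpoints
    are at distance at least 1, so \<open>damp_lower 1\<close> may be divided out, and
    \<open>s \<ge> 1\<close> turns the maximum into a multiple of \<open>s\<close>.\<close>
  define A0 where "A0 = max 1 weight / damp_lower 1"
  define A1 where "A1 = (A0 + 2) * \<rho>"
  \<comment> \<open>2^N comes from the root, one factor 2 from the two terms of
    \<open>sesqui\<close>, and one from the halved lower bound in
    \<open>alternating_growth\<close>.\<close>
  define W where "W = (2::real) ^ (N + 2)"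
  have dl: "damp_lower 1 > 0" by (rule damp_lower_pos) simp
  have A0: "A0 > 0" unfolding A0_def using dl by (intro divide_pos_pos) auto
  have A1: "A1 > 0" unfolding A1_def using A0 \<rho> by simp
  have W: "W > 0" by (simp add: W_def)
  \<comment> \<open>Chosen so that W A1^2 / t \<le> 1/2; the term quadratic in \<open>s\<close> then
    takes at most half of the left side and can be absorbed.\<close>
  define t where "t = \<rho> + 2 * W * A1\<^sup>2"
  have t: "t > \<rho>" unfolding t_def using W A1 by simp
  have "norm (coeff p (N - 1)) \<le> max 1 ((2 * W * A1)\<^sup>2)"
    if row: "row_solution f g" and alt: "alternating p"
      and eq: "\<And>z. z \<notin> cut \<Longrightarrow> sesqui f g z * bands_root z = poly p z"
      and fb: "\<And>z. z \<notin> cut \<Longrightarrow> norm (f z * damp z) \<le> max 1 (sqrt (norm (coeff p (N - 1))) * weight)"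
      and gb: "\<And>z. z \<notin> cut \<Longrightarrow> norm (g z * damp z) \<le> max 1 (sqrt (norm (coeff p (N - 1))) * weight)"
    for f g p
  proof (cases "norm (coeff p (N - 1)) \<le> 1")
    case False
    define s where "s = sqrt (norm (coeff p (N - 1)))"
    have s1: "s \<ge> 1" using False by (simp add: s_def)
    have s2: "s * s = norm (coeff p (N - 1))" by (simp add: s_def)
    have far: "\<rho>1 \<le> norm z" if "norm z > \<rho>" for z :: complex using that by (simp add: \<rho>_def)
    have bound: "norm (h z) \<le> A0 * s"
      if h: "norm (h z * damp z) \<le> max 1 (s * weight)" and z: "norm z > \<rho>"
      for h :: "complex \<Rightarrow> complex" and z
    proof -
      have "damp_lower 1 \<le> norm (damp z)"
        using \<rho>1[OF far[OF z]] by (intro norm_damp_ge) auto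
      then have "norm (h z) * damp_lower 1 \<le> norm (h z * damp z)"
        unfolding norm_mult by (intro mult_left_mono) auto
      also have "\<dots> \<le> max 1 (s * weight)" by (rule h)
      also have "\<dots> \<le> max 1 weight * s"
      proof (rule max.boundedI)
        show "1 \<le> max 1 weight * s" using s1 mult_mono[of 1 "max 1 weight" 1 s] by simp
        show "s * weight \<le> max 1 weight * s"
          using s1 by (simp add: mult.commute mult_left_mono)
      qed
      finally show ?thesis unfolding A0_def using dl by (simp add: field_simps)
    qed
    \<comment> \<open>The summand 2 covers the subtraction of the limit 1 from \<open>f\<close> and
      leaves the strict inequality that the Schwarz lemma requires.\<close>
    define A where "A = (A0 * s + 2) * \<rho>"
    have A: "A \<ge> 0" using A0 s1 \<rho> by (simp add: A_def)
    have A_le: "A \<le> A1 * s"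
    proof -
      have "(A0 * s + 2) * \<rho> \<le> (A0 * s + 2 * s) * \<rho>"
        using s1 \<rho> by (intro mult_right_mono) auto
      then show ?thesis unfolding A_def A1_def by (simp add: algebra_simps)
    qed
    have dom: "{z. norm z > \<rho>} \<subseteq> - cut" using \<rho>1 far by auto
    have g_dec: "norm (g z) \<le> A / norm z" if z: "norm z > \<rho>" for z
      unfolding A_def
    proof (rule Schwarz_at_infinity[OF _ \<rho> _ _ z])
      show "g holomorphic_on {z. norm z > \<rho>}"
        using row_solution_holomorphic(2)[OF row] dom by (rule holomorphic_on_subset)
      show "(g \<longlongrightarrow> 0) at_infinity" by (rule row_solution_tendsto_0[OF row])
      show "norm (g w) < A0 * s + 2" if "norm w > \<rho>" for w
        using bound[of g w] gb[of w] dom that by (force simp: s_def)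
    qed
    have f_dec: "norm (f z - 1) \<le> A / norm z" if z: "norm z > \<rho>" for z
      unfolding A_def
    proof (rule Schwarz_at_infinity[OF _ \<rho> _ _ z])
      show "(\<lambda>z. f z - 1) holomorphic_on {z. norm z > \<rho>}"
        using row_solution_holomorphic(1)[OF row] dom by (intro holomorphic_intros) (rule holomorphic_on_subset)
      show "((\<lambda>z. f z - 1) \<longlongrightarrow> 0) at_infinity"
        using tendsto_diff[OF row_solution_infinity(1)[OF row] tendsto_const[of 1]] by simp
      show "norm (f w - 1) < A0 * s + 2" if w: "norm w > \<rho>" for w
      proof -
        have "norm (f w) \<le> A0 * s" using bound[of f w] fb[of w] dom w by (force simp: s_def)
        then show ?thesis using norm_triangle_ineq4[of "f w" 1] by simp
      qed
    qed
    have f_dec': "norm (f z) \<le> 1 + A / norm z" if "norm z > \<rho>" for z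
      using f_dec[OF that] norm_triangle_ineq2[of "f z" 1] by simp
    define z where "z = complex_of_real t"
    have nz: "norm z = t" "norm (cnj z) = t" "norm z > \<rho>" using t \<rho> by (simp_all add: z_def)
    have t0: "t > 0" using t \<rho> by simp
    have zc: "z \<notin> cut" using dom nz(3) by auto
    have "norm (sesqui f g z) \<le> norm (f z) * norm (g (cnj z)) + norm (g z) * norm (f (cnj z))"
      unfolding sesqui_def using norm_triangle_ineq4[of "f z * cnj (g (cnj z))" "g z * cnj (f (cnj z))"]
      by (simp add: norm_mult)
    also have "\<dots> \<le> (1 + A / t) * (A / t) + (A / t) * (1 + A / t)"
      using f_dec'[of z] f_dec'[of "cnj z"] g_dec[of z] g_dec[of "cnj z"] nz A t0
      by (intro add_mono mult_mono) auto
    also have "\<dots> = 2 * ((1 + A / t) * (A / t))" by (simp only: mult_2 mult.commute)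
    finally have sq: "norm (sesqui f g z) \<le> 2 * ((1 + A / t) * (A / t))" .
    have "norm (coeff p (N - 1)) * t ^ (N - 1) / 2 \<le> norm (poly p z)"
      using \<rho>1[OF far[OF nz(3)]] alt nz(1) by auto
    also have "\<dots> = norm (sesqui f g z) * norm (bands_root z)"
      unfolding eq[OF zc, symmetric] norm_mult ..
    also have "\<dots> \<le> 2 * ((1 + A / t) * (A / t)) * (2 * t) ^ N"
      using sq \<rho>1[OF far[OF nz(3)]] nz(1) A t0
      by (intro mult_mono norm_bands_root_le) auto
    also have "\<dots> = (2 * 2 ^ N * ((1 + A / t) * A)) * t ^ (N - 1)"
      using N_ge_1 t0 by (cases N) (auto simp: power_mult_distrib)
    finally have "norm (coeff p (N - 1)) / 2 * t ^ (N - 1) \<le> (2 * 2 ^ N * ((1 + A / t) * A)) * t ^ (N - 1)"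
      by simp
    then have "norm (coeff p (N - 1)) / 2 \<le> 2 * 2 ^ N * ((1 + A / t) * A)"
      using t0 by (simp only: mult_le_cancel_right) auto
    then have "s * s \<le> W * (A + A * A / t)"
      unfolding s2 W_def by (simp add: algebra_simps)
    also have "\<dots> \<le> W * (A1 * s + (A1 * s) * (A1 * s) / t)"
      using A_le A W t0 by (intro mult_left_mono add_mono divide_right_mono mult_mono) auto
    also have "\<dots> = W * A1 * s + (s * s) * (W * A1\<^sup>2 / t)"
      by (simp add: algebra_simps power2_eq_square)
    also have "\<dots> \<le> W * A1 * s + (s * s) * (1/2)"
    proof -
      have "W * A1\<^sup>2 / t \<le> 1/2" using t0 \<rho> unfolding t_def by (simp add: field_simps)
      then show ?thesis by (intro add_left_mono mult_left_mono) auto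
    qed
    finally have "s * s \<le> (2 * W * A1) * s" by simp
    then have "s \<le> 2 * W * A1" using s1 by simp
    then have "s * s \<le> (2 * W * A1) * (2 * W * A1)" using s1 W A1 by (intro mult_mono) auto
    then show ?thesis unfolding s2 by (simp add: power2_eq_square)
  qed simp
  then show thesis by (intro that[of "max 1 ((2 * W * A1)\<^sup>2)"]) auto
qed

text \<open>The constant is fixed before any row is given. The distance \<epsilon> enters only
  through the division by \<open>damp_lower \<epsilon>\<close>.\<close>

lemma row_uniform_bound:
  assumes "\<epsilon> > 0"
  obtains C where "\<And>f g z. row_solution f g \<Longrightarrow> z \<notin> cut \<Longrightarrow>
      (\<And>k. k \<in> {1..N} \<Longrightarrow> \<epsilon> \<le> norm (z - of_real (a k)) \<and> \<epsilon> \<le> norm (z - of_real (b k))) \<Longrightarrow>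
      norm (f z) \<le> C \<and> norm (g z) \<le> C"
proof -
  obtain G where G: "G \<ge> 0" and bound: "\<And>f g p. row_solution f g \<Longrightarrow> alternating p \<Longrightarrow>
      (\<And>z. z \<notin> cut \<Longrightarrow> sesqui f g z * bands_root z = poly p z) \<Longrightarrow>
      (\<And>z. z \<notin> cut \<Longrightarrow> norm (f z * damp z) \<le> max 1 (sqrt (norm (coeff p (N - 1))) * weight)) \<Longrightarrow>
      (\<And>z. z \<notin> cut \<Longrightarrow> norm (g z * damp z) \<le> max 1 (sqrt (norm (coeff p (N - 1))) * weight)) \<Longrightarrow>
      norm (coeff p (N - 1)) \<le> G"
    by (rule lead_coeff_bound) blast
  show thesis
  proof (rule that[of "max 1 (sqrt G * weight) / damp_lower \<epsilon>"])
    fix f g z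
    assume row: "row_solution f g" and z: "z \<notin> cut"
      and away: "\<And>k. k \<in> {1..N} \<Longrightarrow> \<epsilon> \<le> norm (z - of_real (a k)) \<and> \<epsilon> \<le> norm (z - of_real (b k))"
    obtain p where alt: "alternating p"
      and eq: "\<And>z. z \<notin> cut \<Longrightarrow> sesqui f g z * bands_root z = poly p z"
      and fb: "\<And>z. z \<notin> cut \<Longrightarrow> norm (f z * damp z) \<le> max 1 (sqrt (norm (coeff p (N - 1))) * weight)"
      and gb: "\<And>z. z \<notin> cut \<Longrightarrow> norm (g z * damp z) \<le> max 1 (sqrt (norm (coeff p (N - 1))) * weight)"
      by (rule row_damped_bound[OF row]) blast
    have "norm (coeff p (N - 1)) \<le> G" by (rule bound[OF row alt eq fb gb])
    then have "sqrt (norm (coeff p (N - 1))) * weight \<le> sqrt G * weight"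
      using weight_nonneg by (intro mult_right_mono) auto
    then have mono: "max 1 (sqrt (norm (coeff p (N - 1))) * weight) \<le> max 1 (sqrt G * weight)" by simp
    have dl: "damp_lower \<epsilon> > 0" "damp_lower \<epsilon> \<le> norm (damp z)"
      using damp_lower_pos norm_damp_ge away assms by auto
    have "norm h \<le> max 1 (sqrt G * weight) / damp_lower \<epsilon>"
      if "norm (h * damp z) \<le> max 1 (sqrt (norm (coeff p (N - 1))) * weight)" for h
    proof -
      have "norm h * damp_lower \<epsilon> \<le> norm (h * damp z)"
        unfolding norm_mult using dl by (intro mult_left_mono) auto
      then have "norm h * damp_lower \<epsilon> \<le> max 1 (sqrt G * weight)" using that mono by linarith
      then show ?thesis using dl by (simp add: le_divide_eq)
    qed
    then show "norm (f z) \<le> max 1 (sqrt G * weight) / damp_lower \<epsilon> \<and>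
        norm (g z) \<le> max 1 (sqrt G * weight) / damp_lower \<epsilon>"
      using fb[OF z] gb[OF z] by blast
  qed
qed

end

subsection \<open>Rows of the matrix solution\<close>

abbreviation (input) entry :: "(complex \<Rightarrow> complex ^ 2 ^ 2) \<Rightarrow> 2 \<Rightarrow> 2 \<Rightarrow> complex \<Rightarrow> complex" where
  "entry M i j \<equiv> \<lambda>z. M z $ i $ j"

context band_config
begin

section \<open>Entrywise form of the Riemann-Hilbert conditions\<close>

lemma RHP_entry_holomorphic:
  assumes "solves_model_RHP N a b \<theta> M"
  shows "entry M i j holomorphic_on - cut"
  using assms unfolding solves_model_RHP_def by (blast intro: analytic_imp_holomorphic)

text \<open>The limits are functions of the row index because the determinant combines both rows at
  the same point.\<close>

lemma RHP_band:
  assumes "solves_model_RHP N a b \<theta> M" "k \<in> {1..N}" "a k < x" "x < b k"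
  obtains p q where
    "\<And>i. (entry M i 1 \<longlongrightarrow> p i) (up x)" "\<And>i. (entry M i 2 \<longlongrightarrow> q i) (up x)"
    "\<And>i. (entry M i 1 \<longlongrightarrow> q i) (dn x)" "\<And>i. (entry M i 2 \<longlongrightarrow> - p i) (dn x)"
proof -
  have "has_jump_at M band_jump x"
    using assms unfolding solves_model_RHP_def by auto
  then obtain Mp Mm where lim: "(M \<longlongrightarrow> Mp) (up x)" "(M \<longlongrightarrow> Mm) (dn x)" and eq: "Mp = Mm ** band_jump"
    unfolding has_jump_at_def by blast
  have e: "Mp $ i $ 1 = - (Mm $ i $ 2)" "Mp $ i $ 2 = Mm $ i $ 1" for i
    unfolding eq by (simp_all add: matrix_matrix_mult_def sum_2 band_jump_def vector_2)
  show thesis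
  proof (rule that[of "\<lambda>i. Mp $ i $ 1" "\<lambda>i. Mp $ i $ 2"])
    fix i
    show "(entry M i 1 \<longlongrightarrow> Mp $ i $ 1) (up x)" "(entry M i 2 \<longlongrightarrow> Mp $ i $ 2) (up x)"
      by (intro tendsto_vec_nth lim)+
    have "(entry M i 1 \<longlongrightarrow> Mm $ i $ 1) (dn x)" "(entry M i 2 \<longlongrightarrow> Mm $ i $ 2) (dn x)"
      by (intro tendsto_vec_nth lim)+
    then show "(entry M i 1 \<longlongrightarrow> Mp $ i $ 2) (dn x)" "(entry M i 2 \<longlongrightarrow> - (Mp $ i $ 1)) (dn x)"
      using e by simp_all
  qed
qed

text \<open>Lower limits are expressed through upper ones, so \<open>u\<close> is the inverse of the
  upper left entry of \<open>gap_jump\<close>. As the parameter is real, the inverse of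
  \<open>u\<close> is \<open>cnj u\<close>, and this is the factor of the second column.\<close>

lemma RHP_gap:
  assumes "solves_model_RHP N a b \<theta> M" "k \<in> {1..<N}"
  obtains u where "u * cnj u = 1"
    and "\<And>x. b k < x \<Longrightarrow> x < a (Suc k) \<Longrightarrow> \<exists>p q. \<forall>i.
      (entry M i 1 \<longlongrightarrow> p i) (up x) \<and> (entry M i 2 \<longlongrightarrow> q i) (up x) \<and>
      (entry M i 1 \<longlongrightarrow> u * p i) (dn x) \<and> (entry M i 2 \<longlongrightarrow> cnj u * q i) (dn x)"
proof (rule that[of "exp (2 * of_real pi * \<i> * of_real (\<theta> k))"])
  let ?u = "exp (2 * of_real pi * \<i> * of_real (\<theta> k)) :: complex"
  have cu: "cnj ?u = exp (- 2 * of_real pi * \<i> * of_real (\<theta> k))"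
    by (simp add: exp_cnj)
  show uu: "?u * cnj ?u = 1"
    unfolding cu by (simp flip: exp_add)
  fix x assume "b k < x" "x < a (Suc k)"
  then have "has_jump_at M (gap_jump (\<theta> k)) x"
    using assms unfolding solves_model_RHP_def by auto
  then obtain Mp Mm where lim: "(M \<longlongrightarrow> Mp) (up x)" "(M \<longlongrightarrow> Mm) (dn x)" and eq: "Mp = Mm ** gap_jump (\<theta> k)"
    unfolding has_jump_at_def by blast
  have e: "Mp $ i $ 1 = Mm $ i $ 1 * cnj ?u" "Mp $ i $ 2 = Mm $ i $ 2 * ?u" for i
    unfolding eq cu by (simp_all add: matrix_matrix_mult_def sum_2 gap_jump_def vector_2)
  have e': "?u * Mp $ i $ 1 = Mm $ i $ 1" "cnj ?u * Mp $ i $ 2 = Mm $ i $ 2" for i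
  proof -
    have "?u * Mp $ i $ 1 = (?u * cnj ?u) * Mm $ i $ 1" "cnj ?u * Mp $ i $ 2 = (?u * cnj ?u) * Mm $ i $ 2"
      unfolding e by (simp_all only: mult_ac)
    then show "?u * Mp $ i $ 1 = Mm $ i $ 1" "cnj ?u * Mp $ i $ 2 = Mm $ i $ 2"
      unfolding uu by simp_all
  qed
  show "\<exists>p q. \<forall>i.
      (entry M i 1 \<longlongrightarrow> p i) (up x) \<and> (entry M i 2 \<longlongrightarrow> q i) (up x) \<and>
      (entry M i 1 \<longlongrightarrow> ?u * p i) (dn x) \<and> (entry M i 2 \<longlongrightarrow> cnj ?u * q i) (dn x)"
    by (rule exI[of _ "\<lambda>i. Mp $ i $ 1"], rule exI[of _ "\<lambda>i. Mp $ i $ 2"])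
      (unfold e', intro allI conjI tendsto_vec_nth lim)
qed

lemma RHP_infinity:
  assumes "solves_model_RHP N a b \<theta> M"
  shows "\<exists>B. eventually (\<lambda>z. norm (entry M i j z - (if i = j then 1 else 0)) * norm z \<le> B) at_infinity"
proof -
  have "(\<lambda>z. (M z - mat 1) $ i $ j) \<in> O[at_infinity](\<lambda>z. 1 / z)"
    using assms unfolding solves_model_RHP_def by blast
  then obtain B where "eventually (\<lambda>z. norm ((M z - mat 1) $ i $ j) \<le> B * norm (1 / z)) at_infinity"
    by (elim landau_o.bigE)
  then have "eventually (\<lambda>z. norm (entry M i j z - (if i = j then 1 else 0)) * norm z \<le> B) at_infinity"
    using eventually_not_equal_at_infinity[of 0]
    by eventually_elim (simp add: norm_divide pos_le_divide_eq mat_def)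
  then show ?thesis by blast
qed

lemma RHP_limit:
  assumes "solves_model_RHP N a b \<theta> M"
  shows "(entry M i j \<longlongrightarrow> (if i = j then 1 else 0)) at_infinity"
proof -
  obtain B where "eventually (\<lambda>z. norm (entry M i j z - (if i = j then 1 else 0)) * norm z \<le> B) at_infinity"
    using RHP_infinity[OF assms] by blast
  then have "eventually (\<lambda>z. norm (entry M i j z - (if i = j then 1 else 0)) \<le> B * norm (inverse z)) at_infinity"
    using eventually_not_equal_at_infinity[of 0]
    by eventually_elim (simp add: norm_inverse pos_le_divide_eq flip: divide_inverse)
  moreover have "((\<lambda>z::complex. B * norm (inverse z)) \<longlongrightarrow> 0) at_infinity"
    by (intro tendsto_mult_right_zero tendsto_norm_zero tendsto_inverse_0)
  ultimately have "((\<lambda>z. entry M i j z - (if i = j then 1 else 0)) \<longlongrightarrow> 0) at_infinity"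
    by (rule Lim_null_comparison)
  then show ?thesis by (simp add: LIM_zero_iff)
qed

lemma RHP_endpoint:
  assumes "solves_model_RHP N a b \<theta> M" "c \<in> endpoints"
  obtains B where "eventually (\<lambda>z. \<forall>i j. norm (entry M i j z) * norm (z - c) powr (1/4) \<le> B) (at c within - cut)"
proof -
  have one: "\<exists>B. eventually (\<lambda>z. norm (entry M i j z) * norm (z - c) powr (1/4) \<le> B) (at c within - cut)" for i j
  proof -
    obtain r where r: "r \<in> a ` {1..N} \<union> b ` {1..N}" "c = of_real r"
      using assms(2) by (auto simp: endpoints_def)
    have "\<forall>c \<in> a ` {1..N} \<union> b ` {1..N}. \<forall>i j.
        (\<lambda>z. norm (M z $ i $ j))
          \<in> O[at (of_real c) within (- rhp_cut N a b)](\<lambda>z. norm (z - of_real c) powr (- 1 / 4))"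
      using assms(1) unfolding solves_model_RHP_def by (elim conjE)
    then have "(\<lambda>z. norm (entry M i j z)) \<in> O[at c within - cut](\<lambda>z. norm (z - c) powr (- 1 / 4))"
      using r by blast
    then obtain B where "eventually (\<lambda>z. norm (norm (entry M i j z)) \<le> B * norm (norm (z - c) powr (- 1 / 4))) (at c within - cut)"
      by (elim landau_o.bigE)
    moreover have "eventually (\<lambda>z. z \<noteq> c) (at c within - cut)"
      by (auto simp: eventually_at_filter)
    ultimately have "eventually (\<lambda>z. norm (entry M i j z) * norm (z - c) powr (1/4) \<le> B) (at c within - cut)"
    proof eventually_elim
      case (elim z)
      have "norm (entry M i j z) * norm (z - c) powr (1/4) \<le>
          B * norm (z - c) powr (- 1 / 4) * norm (z - c) powr (1/4)"
        using elim by (intro mult_right_mono) auto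
      also have "\<dots> = B * (norm (z - c) powr (- 1 / 4 + 1 / 4))"
        by (simp only: powr_add mult.assoc)
      also have "\<dots> = B" using elim by simp
      finally show ?case .
    qed
    then show ?thesis by blast
  qed
  then have "\<forall>i j. \<exists>B. eventually (\<lambda>z. norm (entry M i j z) * norm (z - c) powr (1/4) \<le> B) (at c within - cut)"
    by (intro allI)
  then obtain B where B: "\<forall>i j. eventually (\<lambda>z. norm (entry M i j z) * norm (z - c) powr (1/4) \<le> B i j) (at c within - cut)"
    unfolding choice_iff by (elim exE)
  have "eventually (\<lambda>z. \<forall>i j. norm (entry M i j z) * norm (z - c) powr (1/4) \<le> B i j) (at c within - cut)"
    using B by (simp add: eventually_all_finite)
  then have "eventually (\<lambda>z. \<forall>i j. norm (entry M i j z) * norm (z - c) powr (1/4) \<le> (MAX x. case x of (i, j) \<Rightarrow> B i j)) (at c within - cut)"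
  proof eventually_elim
    case (elim z)
    have "B i j \<le> (MAX x. case x of (i, j) \<Rightarrow> B i j)" for i j
      by (rule Max_ge) (auto intro: image_eqI[of _ _ "(i, j)"])
    then show ?case using elim by (blast intro: order.trans)
  qed
  then show thesis by (rule that)
qed

lemma norm_eq_1_if_mult_cnj: "u * cnj u = 1 \<Longrightarrow> norm u = 1"
  by (metis complex_mod_cnj norm_mult norm_one real_sqrt_abs2 real_sqrt_one abs_norm_cancel)

lemma row_solution_first_row:
  assumes "solves_model_RHP N a b \<theta> M"
  shows "row_solution (entry M 1 1) (entry M 1 2)"
  unfolding row_solution_def
proof (intro conjI ballI)
  show "entry M 1 1 holomorphic_on - cut" "entry M 1 2 holomorphic_on - cut"
    by (rule RHP_entry_holomorphic[OF assms])+
  show "(entry M 1 1 \<longlongrightarrow> 1) at_infinity"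
    using RHP_limit[OF assms, of 1 1] by (simp add: mat_def)
  show "\<exists>B. eventually (\<lambda>z. norm (entry M 1 2 z) * norm z \<le> B) at_infinity"
    using RHP_infinity[OF assms, of 1 2] by (simp add: mat_def)
next
  fix k x assume k: "k \<in> {1..N}" and x: "x \<in> {a k<..<b k}"
  then have x': "a k < x" "x < b k" by auto
  obtain p q where l: "\<And>i. (entry M i 1 \<longlongrightarrow> p i) (up x)" "\<And>i. (entry M i 2 \<longlongrightarrow> q i) (up x)"
      "\<And>i. (entry M i 1 \<longlongrightarrow> q i) (dn x)" "\<And>i. (entry M i 2 \<longlongrightarrow> - p i) (dn x)"
    by (rule RHP_band[OF assms k x']) blast
  show "\<exists>p q. (entry M 1 1 \<longlongrightarrow> p) (up x) \<and> (entry M 1 2 \<longlongrightarrow> q) (up x) \<and>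
      (entry M 1 1 \<longlongrightarrow> q) (dn x) \<and> (entry M 1 2 \<longlongrightarrow> - p) (dn x)"
    using l[of 1] by blast
next
  fix k assume k: "k \<in> {1..<N}"
  obtain u where u: "u * cnj u = 1" "\<And>x. b k < x \<Longrightarrow> x < a (Suc k) \<Longrightarrow> \<exists>p q. \<forall>i.
      (entry M i 1 \<longlongrightarrow> p i) (up x) \<and> (entry M i 2 \<longlongrightarrow> q i) (up x) \<and>
      (entry M i 1 \<longlongrightarrow> u * p i) (dn x) \<and> (entry M i 2 \<longlongrightarrow> cnj u * q i) (dn x)"
    by (rule RHP_gap[OF assms k]) blast
  show "\<exists>u. norm u = 1 \<and> (\<forall>x\<in>{b k<..<a (Suc k)}. \<exists>p q.
      (entry M 1 1 \<longlongrightarrow> p) (up x) \<and> (entry M 1 2 \<longlongrightarrow> q) (up x) \<and>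
      (entry M 1 1 \<longlongrightarrow> u * p) (dn x) \<and> (entry M 1 2 \<longlongrightarrow> cnj u * q) (dn x))"
  proof (rule exI[of _ u], intro conjI ballI)
    show "norm u = 1" by (rule norm_eq_1_if_mult_cnj[OF u(1)])
    fix x assume "x \<in> {b k<..<a (Suc k)}"
    then obtain p q where "\<forall>i. (entry M i 1 \<longlongrightarrow> p i) (up x) \<and> (entry M i 2 \<longlongrightarrow> q i) (up x) \<and>
      (entry M i 1 \<longlongrightarrow> u * p i) (dn x) \<and> (entry M i 2 \<longlongrightarrow> cnj u * q i) (dn x)"
      using u(2)[of x] by auto
    from spec[OF this, of 1] show "\<exists>p q. (entry M 1 1 \<longlongrightarrow> p) (up x) \<and> (entry M 1 2 \<longlongrightarrow> q) (up x) \<and>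
      (entry M 1 1 \<longlongrightarrow> u * p) (dn x) \<and> (entry M 1 2 \<longlongrightarrow> cnj u * q) (dn x)"
      by blast
  qed
next
  fix c assume c: "c \<in> endpoints"
  obtain B where "eventually (\<lambda>z. \<forall>i j. norm (entry M i j z) * norm (z - c) powr (1/4) \<le> B) (at c within - cut)"
    by (rule RHP_endpoint[OF assms c])
  then have "eventually (\<lambda>z. norm (entry M 1 1 z) * norm (z - c) powr (1/4) \<le> B \<and>
      norm (entry M 1 2 z) * norm (z - c) powr (1/4) \<le> B) (at c within - cut)"
    by (rule eventually_mono) simp
  then show "\<exists>B. eventually (\<lambda>z. norm (entry M 1 1 z) * norm (z - c) powr (1/4) \<le> B \<and>
      norm (entry M 1 2 z) * norm (z - c) powr (1/4) \<le> B) (at c within - cut)"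
    by blast
qed

text \<open>Passing from (m1, m2) to (m2, -m1) is right multiplication by the negative of
  \<open>band_jump\<close>. It commutes with the band jump and exchanges the diagonal entries of the
  gap jump, so \<open>u\<close> becomes \<open>cnj u\<close>.\<close>

lemma row_solution_second_row:
  assumes "solves_model_RHP N a b \<theta> M"
  shows "row_solution (entry M 2 2) (\<lambda>z. - entry M 2 1 z)"
  unfolding row_solution_def
proof (intro conjI ballI)
  show "entry M 2 2 holomorphic_on - cut" "(\<lambda>z. - entry M 2 1 z) holomorphic_on - cut"
    by (intro holomorphic_intros RHP_entry_holomorphic[OF assms])+
  show "(entry M 2 2 \<longlongrightarrow> 1) at_infinity"
    using RHP_limit[OF assms, of 2 2] by (simp add: mat_def)
  show "\<exists>B. eventually (\<lambda>z. norm (- entry M 2 1 z) * norm z \<le> B) at_infinity"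
    using RHP_infinity[OF assms, of 2 1] by (simp add: mat_def)
next
  fix k x assume k: "k \<in> {1..N}" and x: "x \<in> {a k<..<b k}"
  then have x': "a k < x" "x < b k" by auto
  obtain p q where l: "\<And>i. (entry M i 1 \<longlongrightarrow> p i) (up x)" "\<And>i. (entry M i 2 \<longlongrightarrow> q i) (up x)"
      "\<And>i. (entry M i 1 \<longlongrightarrow> q i) (dn x)" "\<And>i. (entry M i 2 \<longlongrightarrow> - p i) (dn x)"
    by (rule RHP_band[OF assms k x']) blast
  show "\<exists>p q. (entry M 2 2 \<longlongrightarrow> p) (up x) \<and> ((\<lambda>z. - entry M 2 1 z) \<longlongrightarrow> q) (up x) \<and>
      (entry M 2 2 \<longlongrightarrow> q) (dn x) \<and> ((\<lambda>z. - entry M 2 1 z) \<longlongrightarrow> - p) (dn x)"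
    using l(2,4)[of 2] tendsto_minus[OF l(1)[of 2]] tendsto_minus[OF l(3)[of 2]] by blast
next
  fix k assume k: "k \<in> {1..<N}"
  obtain u where u: "u * cnj u = 1" "\<And>x. b k < x \<Longrightarrow> x < a (Suc k) \<Longrightarrow> \<exists>p q. \<forall>i.
      (entry M i 1 \<longlongrightarrow> p i) (up x) \<and> (entry M i 2 \<longlongrightarrow> q i) (up x) \<and>
      (entry M i 1 \<longlongrightarrow> u * p i) (dn x) \<and> (entry M i 2 \<longlongrightarrow> cnj u * q i) (dn x)"
    by (rule RHP_gap[OF assms k]) blast
  show "\<exists>u. norm u = 1 \<and> (\<forall>x\<in>{b k<..<a (Suc k)}. \<exists>p q.
      (entry M 2 2 \<longlongrightarrow> p) (up x) \<and> ((\<lambda>z. - entry M 2 1 z) \<longlongrightarrow> q) (up x) \<and>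
      (entry M 2 2 \<longlongrightarrow> u * p) (dn x) \<and> ((\<lambda>z. - entry M 2 1 z) \<longlongrightarrow> cnj u * q) (dn x))"
  proof (rule exI[of _ "cnj u"], intro conjI ballI)
    show "norm (cnj u) = 1" using norm_eq_1_if_mult_cnj[OF u(1)] by simp
    fix x assume "x \<in> {b k<..<a (Suc k)}"
    then obtain p q where "\<forall>i. (entry M i 1 \<longlongrightarrow> p i) (up x) \<and> (entry M i 2 \<longlongrightarrow> q i) (up x) \<and>
      (entry M i 1 \<longlongrightarrow> u * p i) (dn x) \<and> (entry M i 2 \<longlongrightarrow> cnj u * q i) (dn x)"
      using u(2)[of x] by auto
    note l = spec[OF this, of 2, THEN conjunct2, THEN conjunct1] spec[OF this, of 2, THEN conjunct1]
      spec[OF this, of 2, THEN conjunct2, THEN conjunct2, THEN conjunct1]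
      spec[OF this, of 2, THEN conjunct2, THEN conjunct2, THEN conjunct2]
    have "((\<lambda>z. - entry M 2 1 z) \<longlongrightarrow> cnj (cnj u) * (- p 2)) (dn x)"
      using tendsto_minus[OF l(3)] by simp
    then show "\<exists>p q. (entry M 2 2 \<longlongrightarrow> p) (up x) \<and> ((\<lambda>z. - entry M 2 1 z) \<longlongrightarrow> q) (up x) \<and>
      (entry M 2 2 \<longlongrightarrow> cnj u * p) (dn x) \<and> ((\<lambda>z. - entry M 2 1 z) \<longlongrightarrow> cnj (cnj u) * q) (dn x)"
      using l(1,4) tendsto_minus[OF l(2)] by blast
  qed
next
  fix c assume c: "c \<in> endpoints"
  obtain B where "eventually (\<lambda>z. \<forall>i j. norm (entry M i j z) * norm (z - c) powr (1/4) \<le> B) (at c within - cut)"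
    by (rule RHP_endpoint[OF assms c])
  then have "eventually (\<lambda>z. norm (entry M 2 2 z) * norm (z - c) powr (1/4) \<le> B \<and>
      norm (- entry M 2 1 z) * norm (z - c) powr (1/4) \<le> B) (at c within - cut)"
    by (rule eventually_mono) simp
  then show "\<exists>B. eventually (\<lambda>z. norm (entry M 2 2 z) * norm (z - c) powr (1/4) \<le> B \<and>
      norm (- entry M 2 1 z) * norm (z - c) powr (1/4) \<le> B) (at c within - cut)"
    by blast
qed

text \<open>Both jump matrices have determinant one, so the determinant has no jump and extends to
  an entire function; its limit at infinity is 1, and Liouville's theorem concludes.\<close>

lemma RHP_det:
  assumes "solves_model_RHP N a b \<theta> M" "z \<notin> cut"
  shows "det (M z) = 1"
proof -
  define d where "d z = entry M 1 1 z * entry M 2 2 z - entry M 1 2 z * entry M 2 1 z" for z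
  have hol: "d holomorphic_on - cut"
    unfolding d_def[abs_def] by (intro holomorphic_intros RHP_entry_holomorphic[OF assms(1)])
  have band: "\<exists>L. (d \<longlongrightarrow> L) (up x) \<and> (d \<longlongrightarrow> L) (dn x)" if k: "k \<in> {1..N}" and x: "a k < x" "x < b k" for k x
  proof -
    obtain p q where l: "\<And>i. (entry M i 1 \<longlongrightarrow> p i) (up x)" "\<And>i. (entry M i 2 \<longlongrightarrow> q i) (up x)"
      "\<And>i. (entry M i 1 \<longlongrightarrow> q i) (dn x)" "\<And>i. (entry M i 2 \<longlongrightarrow> - p i) (dn x)"
      by (rule RHP_band[OF assms(1) k x]) blast
    have "(d \<longlongrightarrow> p 1 * q 2 - q 1 * p 2) (up x)"
      unfolding d_def[abs_def] by (intro tendsto_intros l)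
    moreover have "(d \<longlongrightarrow> q 1 * - p 2 - (- p 1) * q 2) (dn x)"
      unfolding d_def[abs_def] by (intro tendsto_diff tendsto_mult l)
    then have "(d \<longlongrightarrow> p 1 * q 2 - q 1 * p 2) (dn x)" by simp
    ultimately show ?thesis by blast
  qed
  have gap: "\<exists>L. (d \<longlongrightarrow> L) (up x) \<and> (d \<longlongrightarrow> L) (dn x)" if k: "k \<in> {1..<N}" and x: "b k < x" "x < a (Suc k)" for k x
  proof -
    obtain u where u: "u * cnj u = 1" "\<And>x. b k < x \<Longrightarrow> x < a (Suc k) \<Longrightarrow> \<exists>p q. \<forall>i.
      (entry M i 1 \<longlongrightarrow> p i) (up x) \<and> (entry M i 2 \<longlongrightarrow> q i) (up x) \<and>
      (entry M i 1 \<longlongrightarrow> u * p i) (dn x) \<and> (entry M i 2 \<longlongrightarrow> cnj u * q i) (dn x)"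
      by (rule RHP_gap[OF assms(1) k]) blast
    then obtain p q where l: "\<And>i. (entry M i 1 \<longlongrightarrow> p i) (up x)" "\<And>i. (entry M i 2 \<longlongrightarrow> q i) (up x)"
      "\<And>i. (entry M i 1 \<longlongrightarrow> u * p i) (dn x)" "\<And>i. (entry M i 2 \<longlongrightarrow> cnj u * q i) (dn x)"
      using x by metis
    have "(d \<longlongrightarrow> p 1 * q 2 - q 1 * p 2) (up x)"
      unfolding d_def[abs_def] by (intro tendsto_intros l)
    moreover have "(d \<longlongrightarrow> (u * p 1) * (cnj u * q 2) - (cnj u * q 1) * (u * p 2)) (dn x)"
      unfolding d_def[abs_def] by (intro tendsto_diff tendsto_mult l)
    moreover have "(u * p 1) * (cnj u * q 2) - (cnj u * q 1) * (u * p 2) = (u * cnj u) * (p 1 * q 2 - q 1 * p 2)"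
      by (simp only: right_diff_distrib mult_ac)
    ultimately show ?thesis using u(1) by auto
  qed
  have ends: "\<exists>B. eventually (\<lambda>z. norm (d z) * sqrt (norm (z - c)) \<le> B) (at c within - cut)"
    if c: "c \<in> endpoints" for c
  proof -
    obtain B where "eventually (\<lambda>z. \<forall>i j. norm (entry M i j z) * norm (z - c) powr (1/4) \<le> B) (at c within - cut)"
      by (rule RHP_endpoint[OF assms(1) c])
    then have "eventually (\<lambda>z. norm (d z) * sqrt (norm (z - c)) \<le> B * B + B * B) (at c within - cut)"
    proof eventually_elim
      case (elim z)
      have "norm (d z) * sqrt (norm (z - c)) \<le>
          (norm (entry M 1 1 z * entry M 2 2 z) + norm (entry M 1 2 z * entry M 2 1 z)) * sqrt (norm (z - c))"
        unfolding d_def by (intro mult_right_mono norm_triangle_ineq4) simp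
      also have "\<dots> \<le> B * B + B * B"
        unfolding distrib_right using elim by (intro add_mono quarter_root_product) auto
      finally show ?case .
    qed
    then show ?thesis by blast
  qed
  obtain h where h: "h holomorphic_on UNIV" "\<And>z. z \<notin> cut \<Longrightarrow> h z = d z"
    by (rule entire_extension[OF hol band gap ends]) blast+
  have "(d \<longlongrightarrow> (if (1::2) = 1 then 1 else 0) * (if (2::2) = 2 then 1 else 0) -
      (if (1::2) = 2 then 1 else 0) * (if (2::2) = 1 then 1 else 0)) at_infinity"
    unfolding d_def[abs_def] by (intro tendsto_diff tendsto_mult RHP_limit[OF assms(1)])
  then have "(d \<longlongrightarrow> 1) at_infinity" by simp
  then have "(h \<longlongrightarrow> 1) at_infinity"
    by (rule Lim_transform_eventually)
      (use eventually_at_infinity_notin_cut in eventually_elim, simp add: h)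
  then have "h z = 1" by (rule Liouville_weak[OF h(1)])
  then show ?thesis using h(2)[OF assms(2)] by (simp add: det_2 d_def)
qed

end

text \<open>The adjugate formula. As \<open>matrix_inv\<close> is defined by choice, the adjugate
  first shows that a two-sided inverse exists and then identifies the chosen one. The entries of the
  inverse are thus those of the matrix up to sign and position, so the same constant bounds
  them.\<close>

lemma matrix_inv_2x2:
  fixes A :: "'a::field ^ 2 ^ 2"
  assumes "det A = 1"
  shows "matrix_inv A = vector [vector [A $ 2 $ 2, - A $ 1 $ 2], vector [- A $ 2 $ 1, A $ 1 $ 1]]" (is "_ = ?B")
proof -
  have d: "A $ 1 $ 1 * A $ 2 $ 2 - A $ 1 $ 2 * A $ 2 $ 1 = 1" using assms by (simp add: det_2)
  have AB: "A ** ?B = mat 1"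
    unfolding vec_eq_iff forall_2 using d
    by (simp add: matrix_matrix_mult_def sum_2 mat_def vector_2) (simp add: algebra_simps)
  have BA: "?B ** A = mat 1"
    unfolding vec_eq_iff forall_2 using d
    by (simp add: matrix_matrix_mult_def sum_2 mat_def vector_2) (simp add: algebra_simps)
  have "A ** matrix_inv A = mat 1 \<and> matrix_inv A ** A = mat 1"
    unfolding matrix_inv_def by (rule someI[of _ ?B]) (simp only: AB BA simp_thms)
  then have inv: "matrix_inv A ** A = mat 1" by simp
  have "matrix_inv A = matrix_inv A ** (A ** ?B)" by (simp only: AB matrix_mul_rid)
  also have "\<dots> = ?B" by (simp only: matrix_mul_assoc inv matrix_mul_lid)
  finally show ?thesis .
qed

theorem proposition4p4:
  fixes N :: nat and a b \<alpha> :: "nat \<Rightarrow> real" and M :: "int \<Rightarrow> complex \<Rightarrow> complex ^ 2 ^ 2"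
  assumes "N \<ge> 1"
    and "\<And>k. k \<in> {1..N} \<Longrightarrow> a k < b k"
    and "\<And>k. k \<in> {1..<N} \<Longrightarrow> b k < a (Suc k)"
    and "\<And>n. solves_model_RHP N a b (\<lambda>k. of_int n * \<alpha> k) (M n)"
  shows "\<forall>\<epsilon>>0. \<exists>C. \<forall>n z.
           z \<notin> rhp_cut N a b \<longrightarrow>
           (\<forall>j\<in>{1..N}. norm (z - of_real (a j)) \<ge> \<epsilon> \<and> norm (z - of_real (b j)) \<ge> \<epsilon>) \<longrightarrow>
           (\<forall>i j. norm (M n z $ i $ j) \<le> C \<and> norm (matrix_inv (M n z) $ i $ j) \<le> C)"
proof (intro allI impI)
  interpret band_config N a b
    by unfold_locales (use assms in auto)
  fix \<epsilon> :: real assume "\<epsilon> > 0"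
  \<comment> \<open>This constant serves every row solution whatever its phases, and therefore every
    \<open>n\<close> at once.\<close>
  then obtain C where C: "\<And>f g z. row_solution f g \<Longrightarrow> z \<notin> rhp_cut N a b \<Longrightarrow>
      (\<And>k. k \<in> {1..N} \<Longrightarrow> \<epsilon> \<le> norm (z - of_real (a k)) \<and> \<epsilon> \<le> norm (z - of_real (b k))) \<Longrightarrow>
      norm (f z) \<le> C \<and> norm (g z) \<le> C"
    by (rule row_uniform_bound) blast
  show "\<exists>C. \<forall>n z. z \<notin> rhp_cut N a b \<longrightarrow>
           (\<forall>j\<in>{1..N}. norm (z - of_real (a j)) \<ge> \<epsilon> \<and> norm (z - of_real (b j)) \<ge> \<epsilon>) \<longrightarrow>
           (\<forall>i j. norm (M n z $ i $ j) \<le> C \<and> norm (matrix_inv (M n z) $ i $ j) \<le> C)"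
  proof (rule exI[of _ C], intro allI impI)
    fix n z i j
    assume z: "z \<notin> rhp_cut N a b"
      and far: "\<forall>j\<in>{1..N}. norm (z - of_real (a j)) \<ge> \<epsilon> \<and> norm (z - of_real (b j)) \<ge> \<epsilon>"
    note sol = assms(4)[of n]
    have rows: "norm (M n z $ 1 $ 1) \<le> C \<and> norm (M n z $ 1 $ 2) \<le> C"
      "norm (M n z $ 2 $ 2) \<le> C \<and> norm (- (M n z $ 2 $ 1)) \<le> C"
      using C[OF row_solution_first_row[OF sol] z] C[OF row_solution_second_row[OF sol] z] far by blast+
    then have M_le: "norm (M n z $ i $ j) \<le> C" for i j
      using exhaust_2[of i] exhaust_2[of j] by auto
    have "norm (matrix_inv (M n z) $ i $ j) \<le> C"
      unfolding matrix_inv_2x2[OF RHP_det[OF sol z]]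
      using M_le exhaust_2[of i] exhaust_2[of j] by (auto simp: vector_2)
    then show "norm (M n z $ i $ j) \<le> C \<and> norm (matrix_inv (M n z) $ i $ j) \<le> C"
      using M_le by blast
  qed
qed

end
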